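(* Let $\lambda\ne0$ be a real number with $\lambda\neq-\tfrac12,-1,-\tfrac32,-2,\dots$, let $x$ be a real variable and let $n,m\ge1$ be integers. Then $$\mathrm{C.T.}\big|_{\mathbf{z}=0}\ \prod_{j=1}^n\frac{(1-2xz_j+z_j^2)^{-\lambda-n+1}}{z_j^{m}}\prod_{1\le i<j\le n}(z_i-z_j)^2\left(1-\frac1{z_iz_j}\right)$$ $$=(-1)^{nm+\binom m2}\,n!\,2^{nm+\binom m2}\left(\prod_{j=0}^{m-1}\frac{(\lambda)_{n+j}}{(2\lambda)_j}\right)\det\left(\frac{(1-x)^{n+i-1}P_{n+i-1}^{2\lambda+j-1,\,-n-i-\lambda+1/2}\left(\frac{x+3}{x-1}\right)}{(2\lambda+2j-1)_{n+i-j}}\right)_{i,j=1}^m.$$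
   Context: $\mathrm{C.T.}|_{\mathbf{z}=0}F(\mathbf{z})$ is the constant term of the Laurent expansion of $F$ at $\mathbf{z}=(z_1,\dots,z_n)=(0,\dots,0)$; $(1-2xz+z^2)^{y}$ is expanded as the power series in $z$ with value $1$ at $z=0$. $(u)_l=u(u+1)\cdots(u+l-1)$ for $l\ge0$, and for possibly negative $l$, $(u)_l=\Gamma(u+l)/\Gamma(u)$; thus $(2\lambda+2j-1)_{n+i-j}=(2\lambda+1)_{n+i+j-2}/(2\lambda+1)_{2j-2}$. The Jacobi polynomials are $$P_n^{\alpha,\beta}(y)=\binom{n+\alpha}{n}\sum_{j=0}^n\frac{2^{-j}(n+\alpha+\beta+1)_j}{(\alpha+1)_j}\binom nj(y-1)^j,$$ with $\binom{n+\alpha}{n}=(\alpha+1)_n/n!$. The expressions $(1-x)^{k}P_k^{\alpha,\beta}\left(\frac{x+3}{x-1}\right)$ are polynomials in $x$ (so they make sense also at $x=1$). *)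

theory Defs
  imports
    "HOL-Analysis.Infinite_Sum"
    "HOL-Analysis.Gamma_Function"
    "Jordan_Normal_Form.Determinant"
begin

text \<open>
  Points of \<open>n\<close>-dimensional complex space are functions read at the indices \<open>1..n\<close> only.
  Unconditional summability (\<open>has_sum\<close>) over all of \<open>\<int>\<^sup>n\<close> on a punctured polydisc determines
  the coefficients of a Laurent expansion uniquely.
\<close>

definition has_Laurent_expansion_at_0 ::
    "nat \<Rightarrow> ((nat \<Rightarrow> complex) \<Rightarrow> complex) \<Rightarrow> ((nat \<Rightarrow> int) \<Rightarrow> complex) \<Rightarrow> bool" where
  "has_Laurent_expansion_at_0 n F c \<longleftrightarrow>
     (\<exists>r>0. \<forall>z. (\<forall>j\<in>{1..n}. z j \<noteq> 0 \<and> norm (z j) < r) \<longrightarrow>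
        ((\<lambda>k. c k * (\<Prod>j=1..n. z j powi k j)) has_sum F z) ({1..n} \<rightarrow>\<^sub>E UNIV))"

definition constant_term :: "nat \<Rightarrow> ((nat \<Rightarrow> complex) \<Rightarrow> complex) \<Rightarrow> complex" where
  "constant_term n F =
     (THE a. \<exists>c. has_Laurent_expansion_at_0 n F c \<and> c (\<lambda>j\<in>{1..n}. 0) = a)"

definition poch :: "real \<Rightarrow> int \<Rightarrow> real" where
  "poch u l = (if 0 \<le> l then pochhammer u (nat l) else Gamma (u + of_int l) / Gamma u)"

definition jacobi_P :: "nat \<Rightarrow> real \<Rightarrow> real \<Rightarrow> real \<Rightarrow> real" where
  "jacobi_P n \<alpha> \<beta> y = pochhammer (\<alpha> + 1) n / fact n *
     (\<Sum>j=0..n. (1 / 2 ^ j) * pochhammer (real n + \<alpha> + \<beta> + 1) j / pochhammer (\<alpha> + 1) j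
                * real (n choose j) * (y - 1) ^ j)"

text \<open>
  The polynomial \<open>(1 - x)\<^sup>k P\<^sub>k((x + 3) / (x - 1))\<close>; treating it as a polynomial (rather than
  as a real expression, where division by zero yields zero) gives it the right value at \<open>x = 1\<close>.
\<close>

definition jacobi_num :: "nat \<Rightarrow> real \<Rightarrow> real \<Rightarrow> real poly" where
  "jacobi_num k \<alpha> \<beta> =
     (THE q. \<forall>x. x \<noteq> 1 \<longrightarrow> poly q x = (1 - x) ^ k * jacobi_P k \<alpha> \<beta> ((x + 3) / (x - 1)))"

lemma jacobi_num_ex1:
  "\<exists>!q. \<forall>x::real. x \<noteq> 1 \<longrightarrow> poly q x = (1 - x) ^ k * jacobi_P k \<alpha> \<beta> ((x + 3) / (x - 1))"
proof (rule ex_ex1I)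
  define A where "A j = (1 / 2 ^ j) * pochhammer (real k + \<alpha> + \<beta> + 1) j / pochhammer (\<alpha> + 1) j
                * real (k choose j)" for j
  let ?q = "smult (pochhammer (\<alpha> + 1) k / fact k)
              (\<Sum>j=0..k. smult (A j * (- 4) ^ j) ([:1, - 1:] ^ (k - j)))"
  have "poly ?q x = (1 - x) ^ k * jacobi_P k \<alpha> \<beta> ((x + 3) / (x - 1))" if "x \<noteq> 1" for x :: real
  proof -
    have y: "(x + 3) / (x - 1) - 1 = (- 4) / (1 - x)"
      using that by (simp add: field_simps)
    have "(1 - x) ^ k * (A j * ((- 4) / (1 - x)) ^ j) = A j * (- 4) ^ j * (1 - x) ^ (k - j)"
      if "j \<le> k" for j
      unfolding power_divide using \<open>x \<noteq> 1\<close> that by (simp add: power_diff)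
    then have "(1 - x) ^ k * (\<Sum>j=0..k. A j * ((- 4) / (1 - x)) ^ j)
        = (\<Sum>j=0..k. A j * (- 4) ^ j * (1 - x) ^ (k - j))"
      unfolding sum_distrib_left by (intro sum.cong) auto
    then show ?thesis
      unfolding jacobi_P_def y A_def[symmetric]
      by (simp add: poly_sum poly_power mult.left_commute)
  qed
  then show "\<exists>q. \<forall>x. x \<noteq> 1 \<longrightarrow> poly q x = (1 - x) ^ k * jacobi_P k \<alpha> \<beta> ((x + 3) / (x - 1))"
    by blast
next
  fix p q :: "real poly"
  assume "\<forall>x. x \<noteq> 1 \<longrightarrow> poly p x = (1 - x) ^ k * jacobi_P k \<alpha> \<beta> ((x + 3) / (x - 1))"
    and "\<forall>x. x \<noteq> 1 \<longrightarrow> poly q x = (1 - x) ^ k * jacobi_P k \<alpha> \<beta> ((x + 3) / (x - 1))"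
  then have "{1<..} \<subseteq> {x. poly (p - q) x = 0}"
    by auto
  then have "infinite {x. poly (p - q) x = 0}"
    using infinite_Ioi infinite_super by blast
  then show "p = q"
    using poly_roots_finite[of "p - q"] by auto
qed

text \<open>\<open>det (a i j)\<close> for \<open>i, j = 1..m\<close> (the rows and columns of \<open>mat\<close> start at \<open>0\<close>).\<close>

definition det1 :: "nat \<Rightarrow> (nat \<Rightarrow> nat \<Rightarrow> real) \<Rightarrow> real" where
  "det1 m a = Determinant.det (mat m m (\<lambda>(i, j). a (Suc i) (Suc j)))"

end

(*
  (z_i - z_j)^2 (1 - 1/(z_i z_j)) = (z_j - z_i)(u_j - u_i) with u = z + 1/z - 2x, so the double product is a product of
  two Vandermonde determinants, in the z_j and in the u_j. Since z u = 1 - 2xz + z^2, a power of u only shifts the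
  exponent lam + n - 1, and the constant term becomes n! times the determinant of the Gegenbauer coefficients
  C^(lam+j)_(m+i-j)(x), i, j < n: up to factors, the minor with rows m..m+n-1 and columns 0..n-1 of the lower triangular
  matrix A that expands the Gegenbauer polynomials C^(lam)_k(y) in powers of y - x.

  Let L be the functional of the Gegenbauer weight, in the variable s = (1 - y)/2, and M_(k,j) = L((y - x)^k s^j).
  Then (A M)_(k,j) = L(C_k s^j) vanishes for k > j, and comparing determinants in
  A [M_top, 1; M_bottom, 0] = [T, *; 0, minor of A], with T triangular, replaces the n x n minor by an m x m
  determinant of M_(n+i,j). These entries are the Jacobi polynomials of the theorem.
*)

theory Submission
  imports Defs "HOL-Complex_Analysis.Laurent_Convergence" "HOL-Library.Real_Mod"
begin

section \<open>Generating functions of the Gegenbauer polynomials\<close>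

text \<open>The Gegenbauer weight is integrable only for lam > -1/2, so L cannot be an integral. It
  is given by its moments of s, rational functions of lam whose denominators are nonzero under the
  hypotheses, and orthogonality becomes a fact about finite differences. That needs the Taylor
  expansion of C_k at y = 1, where the coefficients are quotients of products of linear factors,
  whereas the constant term produces the expansion at y = x; \<open>gegenbauer_taylor\<close> links
  the two. Powers of s are used because (y - x)^k = ((1 - x) - 2s)^k has the same binomial shape as
  (1 - x)^k P_k((x + 3)/(x - 1)). On the analytic side, \<open>constant_term\<close> is a definite
  description, so uniqueness of the constant coefficient has to be shown for sums over all integer
  exponent vectors.\<close>

lemma fps_mult_compose_nth:
  fixes f u w :: "'a::comm_ring_1 fps"
  assumes w: "fps_nth w 0 = 0" and "k \<le> K"
  shows "fps_nth (u * (f oo w)) k = (\<Sum>i\<le>K. fps_nth f i * fps_nth (u * w ^ i) k)"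
proof -
  have c: "fps_nth (f oo w) l = (\<Sum>i\<le>K. fps_nth f i * fps_nth (w ^ i) l)" if "l \<le> k" for l
    unfolding fps_compose_nth
  proof (rule sum.mono_neutral_left)
    show "\<forall>i\<in>{..K} - {0..l}. fps_nth f i * fps_nth (w ^ i) l = 0"
      using startsby_zero_power_prefix[OF w] by (auto simp: not_le)
  qed (use that \<open>k \<le> K\<close> in auto)
  have "fps_nth (u * (f oo w)) k
      = (\<Sum>l=0..k. \<Sum>i\<le>K. fps_nth f i * (fps_nth u l * fps_nth (w ^ i) (k - l)))"
    unfolding fps_mult_nth
    by (intro sum.cong refl) (auto simp: c sum_distrib_left mult_ac)
  also have "\<dots> = (\<Sum>i\<le>K. fps_nth f i * fps_nth (u * w ^ i) k)"
    by (subst sum.swap) (simp add: fps_mult_nth sum_distrib_left)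
  finally show ?thesis .
qed

text \<open>Trinomial revision, \<open>(a gchoose i) * (i choose j) = (a gchoose j) * (a - j gchoose
  (i - j))\<close>, regroups the double binomial expansion by powers of \<open>v\<close>. Since
  \<open>v ^ j * w ^ i\<close> has order at least \<open>i + j\<close>, the triangle of index pairs
  can be completed to a square, and the inner sums become compositions again.\<close>

lemma fps_binomial_compose_add:
  fixes v w :: "'a::field_char_0 fps"
  assumes w: "fps_nth w 0 = 0" and v: "fps_nth v 0 = 0"
  shows "fps_nth (fps_binomial a oo (w + v)) k
    = (\<Sum>j\<le>k. (a gchoose j) * fps_nth (v ^ j * (fps_binomial (a - of_nat j) oo w)) k)"
proof -
  have z: "fps_nth (v ^ j * w ^ i) k = 0" if "i + j > k" for i j
  proof -
    have "fps_nth (v ^ j) l * fps_nth (w ^ i) (k - l) = 0" if "l \<le> k" for l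
    proof (cases "l < j")
      case True
      then show ?thesis using startsby_zero_power_prefix[OF v] by simp
    next
      case False
      then have "k - l < i" using \<open>i + j > k\<close> that by auto
      then show ?thesis using startsby_zero_power_prefix[OF w] by simp
    qed
    then show ?thesis unfolding fps_mult_nth by (intro sum.neutral) auto
  qed
  have "fps_nth (fps_binomial a oo (w + v)) k
      = (\<Sum>i\<le>k. (a gchoose i) * fps_nth ((w + v) ^ i) k)"
    by (simp add: fps_compose_nth atLeast0AtMost)
  also have "\<dots> = (\<Sum>i\<le>k. \<Sum>j\<le>i. (a gchoose i) * of_nat (i choose j) * fps_nth (v ^ j * w ^ (i - j)) k)"
  proof (intro sum.cong refl)
    fix i
    have "(w + v) ^ i = (\<Sum>j\<le>i. of_nat (i choose j) * v ^ j * w ^ (i - j))"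
      by (subst add.commute) (rule binomial_ring)
    then show "(a gchoose i) * fps_nth ((w + v) ^ i) k
       = (\<Sum>j\<le>i. (a gchoose i) * of_nat (i choose j) * fps_nth (v ^ j * w ^ (i - j)) k)"
      by (simp add: fps_sum_nth sum_distrib_left mult.assoc fps_of_nat[symmetric])
  qed
  also have "\<dots> = (\<Sum>i\<le>k. \<Sum>j\<le>i. (a gchoose j) * (a - of_nat j gchoose (i - j)) * fps_nth (v ^ j * w ^ (i - j)) k)"
    by (intro sum.cong refl) (simp add: gbinomial_trinomial_revision[symmetric] binomial_gbinomial)
  also have "\<dots> = (\<Sum>(j,i)\<in>{(j,i). j + i \<le> k}. (a gchoose j) * (a - of_nat j gchoose i) * fps_nth (v ^ j * w ^ i) k)"
    by (rule sum.triangle_reindex_eq[symmetric])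
  also have "\<dots> = (\<Sum>(j,i)\<in>{..k} \<times> {..k}. (a gchoose j) * (a - of_nat j gchoose i) * fps_nth (v ^ j * w ^ i) k)"
  proof (rule sum.mono_neutral_left)
    show "\<forall>ji\<in>{..k} \<times> {..k} - {(j, i). j + i \<le> k}.
      (case ji of (j, i) \<Rightarrow> (a gchoose j) * (a - of_nat j gchoose i) * fps_nth (v ^ j * w ^ i) k) = 0"
    proof
      fix ji assume "ji \<in> {..k} \<times> {..k} - {(j, i). j + i \<le> k}"
      moreover obtain j i where "ji = (j, i)" by fastforce
      ultimately show "(case ji of (j, i) \<Rightarrow>
        (a gchoose j) * (a - of_nat j gchoose i) * fps_nth (v ^ j * w ^ i) k) = 0"
        using z[of i j] by simp
    qed
  qed auto
  also have "\<dots> = (\<Sum>j\<le>k. \<Sum>i\<le>k. (a gchoose j) * (a - of_nat j gchoose i) * fps_nth (v ^ j * w ^ i) k)"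
    by (rule sum.cartesian_product[symmetric])
  also have "\<dots> = (\<Sum>j\<le>k. (a gchoose j) * fps_nth (v ^ j * (fps_binomial (a - of_nat j) oo w)) k)"
    by (simp add: fps_mult_compose_nth[OF w order.refl] sum_distrib_left mult.assoc)
  finally show ?thesis .
qed

text \<open>The series of \<open>1 - 2 * x * z + z ^ 2\<close> raised to \<open>- \<mu>\<close>; its
  \<open>k\<close>-th coefficient is the Gegenbauer polynomial C_k^(\<mu>)(x). The type is left
  general because the kernel needs complex series and the determinants real ones.\<close>

definition gegenbauer_fps :: "'a::field_char_0 \<Rightarrow> 'a \<Rightarrow> 'a fps" where
  "gegenbauer_fps \<mu> x = fps_binomial (- \<mu>) oo (fps_X ^ 2 - fps_const (2 * x) * fps_X)"

text \<open>Replacing \<open>x\<close> by \<open>x + t\<close> adds \<open>- 2 * t * z\<close> to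
  the base of the power, which is the \<open>v\<close> of the preceding expansion. For polynomials
  this is Taylor's formula: the \<open>j\<close>-th derivative of C_k^(\<mu>) is 2^j (\<mu>)_j
  C_(k-j)^(\<mu>+j).\<close>

lemma gegenbauer_taylor:
  "fps_nth (gegenbauer_fps \<mu> (x + t)) k
    = (\<Sum>j\<le>k. 2 ^ j * pochhammer \<mu> j / fact j * t ^ j
         * fps_nth (gegenbauer_fps (\<mu> + of_nat j) x) (k - j))"
proof -
  let ?w = "fps_X ^ 2 - fps_const (2 * x) * fps_X"
  have p: "(- (fps_const (2 * t) * fps_X)) ^ j = fps_const ((- 2 * t) ^ j) * fps_X ^ j" for j
  proof -
    have "- (fps_const (2 * t) * fps_X) = fps_const (- 2 * t) * fps_X"
      by (simp add: fps_eq_iff)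
    then show ?thesis by (simp only: power_mult_distrib fps_const_power)
  qed
  have e: "fps_X ^ 2 - fps_const (2 * (x + t)) * fps_X = ?w + - (fps_const (2 * t) * fps_X)"
    by (simp add: fps_eq_iff algebra_simps)
  have "fps_nth (gegenbauer_fps \<mu> (x + t)) k
    = (\<Sum>j\<le>k. (- \<mu> gchoose j) * fps_nth (fps_const ((- 2 * t) ^ j) * fps_X ^ j * gegenbauer_fps (\<mu> + of_nat j) x) k)"
    unfolding gegenbauer_fps_def e p[symmetric]
    by (subst fps_binomial_compose_add) (auto simp: algebra_simps)
  also have "\<dots> = (\<Sum>j\<le>k. 2 ^ j * pochhammer \<mu> j / fact j * t ^ j
         * fps_nth (gegenbauer_fps (\<mu> + of_nat j) x) (k - j))"
  proof (intro sum.cong refl)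
    fix j assume j: "j \<in> {..k}"
    have e: "(- \<mu> gchoose j) * (- 2 * t) ^ j = 2 ^ j * pochhammer \<mu> j / fact j * t ^ j"
    proof -
      have "(- 2 * t) ^ j = (- 1) ^ j * (2 ^ j * t ^ j)"
        by (simp only: power_mult_distrib[symmetric]) simp
      then show ?thesis by (simp add: gbinomial_pochhammer)
    qed
    have "(- \<mu> gchoose j) * fps_nth (fps_const ((- 2 * t) ^ j) * fps_X ^ j * gegenbauer_fps (\<mu> + of_nat j) x) k
      = ((- \<mu> gchoose j) * (- 2 * t) ^ j) * fps_nth (gegenbauer_fps (\<mu> + of_nat j) x) (k - j)"
      using j by (simp add: mult.assoc fps_X_power_mult_nth)
    then show "(- \<mu> gchoose j) * fps_nth (fps_const ((- 2 * t) ^ j) * fps_X ^ j * gegenbauer_fps (\<mu> + of_nat j) x) k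
      = 2 ^ j * pochhammer \<mu> j / fact j * t ^ j * fps_nth (gegenbauer_fps (\<mu> + of_nat j) x) (k - j)"
      by (simp only: e)
  qed
  finally show ?thesis .
qed

text \<open>At \<open>x = 1\<close> the base is the square of \<open>1 - z\<close>, so the series
  satisfies (1 - z) H' = 2 \<mu> H, and this is a first-order recurrence for its
  coefficients.\<close>

lemma gegenbauer_at_1:
  "fps_nth (gegenbauer_fps \<mu> 1) k = pochhammer (2 * \<mu>) k / fact k"
proof -
  let ?B = "fps_binomial (- \<mu>)"
  let ?g = "fps_X ^ 2 - fps_const (2 * 1) * fps_X :: 'a fps"
  let ?H = "gegenbauer_fps \<mu> 1"
  let ?G = "fps_binomial (- 2 * \<mu>) oo (- fps_X)"
  have B: "(1 + fps_X) * fps_deriv (fps_binomial c) = fps_const c * fps_binomial c" for c :: 'a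
  proof (rule fps_ext)
    fix n
    have "of_nat (Suc n) * (c gchoose Suc n) = (c - of_nat n) * (c gchoose n)"
      by (simp only: gbinomial_absorb_comp[symmetric] gbinomial_absorption)
    then show "fps_nth ((1 + fps_X) * fps_deriv (fps_binomial c)) n = fps_nth (fps_const c * fps_binomial c) n"
      by (cases n) (auto simp: algebra_simps)
  qed
  have comp: "(1 + g) * fps_deriv (fps_binomial c oo g) = fps_const c * (fps_binomial c oo g) * fps_deriv g"
    if g: "fps_nth g 0 = 0" for c and g :: "'a fps"
  proof -
    have "(1 + g) * (fps_deriv (fps_binomial c) oo g) = ((1 + fps_X) * fps_deriv (fps_binomial c)) oo g"
      by (simp add: fps_compose_mult_distrib[OF g] fps_compose_add_distrib fps_X_fps_compose_startby0[OF g])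
    also have "\<dots> = fps_const c * (fps_binomial c oo g)"
      unfolding B by (simp add: fps_compose_mult_distrib[OF g])
    finally show ?thesis
      by (simp add: fps_compose_deriv[OF g] mult.assoc[symmetric])
  qed
  have H: "(1 - fps_X) * fps_deriv ?H = fps_const (2 * \<mu>) * ?H"
  proof -
    have s: "1 + ?g = (1 - fps_X) * (1 - fps_X)" "fps_deriv ?g = - 2 * (1 - fps_X)"
      by (simp_all add: power2_eq_square algebra_simps numeral_fps_const)
    have "(1 - fps_X) * ((1 - fps_X) * fps_deriv ?H) = (1 - fps_X) * (fps_const (2 * \<mu>) * ?H)"
      using comp[of ?g "- \<mu>"] unfolding s gegenbauer_fps_def
      by (simp add: mult_ac numeral_fps_const  flip: fps_const_neg fps_const_mult)
    moreover have "(1 - fps_X :: 'a fps) \<noteq> 0"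
      by (metis diff_zero fps_X_nth fps_one_nth fps_sub_nth fps_zero_nth zero_neq_one)
    ultimately show ?thesis by simp
  qed
  have *: "fps_nth ?H (Suc n) = (2 * \<mu> + of_nat n) / of_nat (Suc n) * fps_nth ?H n" for n
  proof -
    have "(of_nat (Suc n)) * fps_nth ?H (Suc n) = (2 * \<mu> + of_nat n) * fps_nth ?H n"
      using arg_cong[OF H, of "\<lambda>h. fps_nth h n"] by (cases n) (auto simp: algebra_simps)
    then show ?thesis
      by (simp add: nonzero_eq_divide_eq[OF of_nat_neq_0] mult.commute del: of_nat_Suc)
  qed
  show ?thesis
  proof (induction k)
    case 0
    show ?case by (simp add: gegenbauer_fps_def)
  next
    case (Suc k)
    show ?case by (simp only: * Suc.IH) (simp add: pochhammer_Suc mult_ac)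
  qed
qed

text \<open>In the expansion at 1 only Pochhammer symbols, factorials and powers of
  \<open>x - 1\<close> occur, and all of these commute with \<open>of_real\<close>. This carries the
  complex coefficients of the kernel over to the real determinant.\<close>

lemma gegenbauer_of_real:
  "fps_nth (gegenbauer_fps (of_real \<mu> :: 'a::real_field) (of_real x)) k
    = of_real (fps_nth (gegenbauer_fps \<mu> x) k)"
proof -
  have "fps_nth (gegenbauer_fps (of_real \<mu> :: 'a) (1 + of_real (x - 1))) k
    = of_real (fps_nth (gegenbauer_fps \<mu> (1 + (x - 1))) k)"
    unfolding gegenbauer_taylor gegenbauer_at_1
    by (simp add: pochhammer_of_real[symmetric])
  then show ?thesis by simp
qed

section \<open>Orthogonality for the Gegenbauer weight\<close>

lemma alternating_binomial_sum_Suc: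
  fixes f :: "nat \<Rightarrow> 'a::comm_ring_1"
  shows "(\<Sum>l\<le>Suc k. (- 1) ^ l * of_nat (Suc k choose l) * f l)
    = (\<Sum>l\<le>k. (- 1) ^ l * of_nat (k choose l) * f l)
    - (\<Sum>l\<le>k. (- 1) ^ l * of_nat (k choose l) * f (Suc l))"
proof -
  have "(\<Sum>l\<le>Suc k. (- 1) ^ l * of_nat (Suc k choose l) * f l)
     = f 0 + (\<Sum>l\<le>k. (- 1) ^ Suc l * of_nat (k choose Suc l) * f (Suc l))
         + (\<Sum>l\<le>k. (- 1) ^ Suc l * of_nat (k choose l) * f (Suc l))"
    unfolding sum.atMost_Suc_shift by (simp add: algebra_simps sum.distrib sum_subtractf sum_negf)
  also have "f 0 + (\<Sum>l\<le>k. (- 1) ^ Suc l * of_nat (k choose Suc l) * f (Suc l))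
     = (\<Sum>l\<le>Suc k. (- 1) ^ l * of_nat (k choose l) * f l)"
    unfolding sum.atMost_Suc_shift by simp
  also have "\<dots> = (\<Sum>l\<le>k. (- 1) ^ l * of_nat (k choose l) * f l)"
    by (simp add: binomial_eq_0)
  finally show ?thesis by (simp add: sum_negf)
qed

text \<open>A polynomial of degree below \<open>k\<close> has vanishing \<open>k\<close>-th
  difference. It is kept as a product of linear factors, the form in which Pochhammer symbols supply
  it; absorbing \<open>l\<close> into the binomial coefficient removes one factor, lowers
  \<open>k\<close> by 1 and shifts every \<open>c i\<close> by 1.\<close>

lemma alternating_binomial_sum_prod:
  fixes c :: "nat \<Rightarrow> 'a::comm_ring_1"
  assumes "d < k"
  shows "(\<Sum>l\<le>k. (- 1) ^ l * of_nat (k choose l) * (\<Prod>i<d. c i + of_nat l)) = 0"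
  using assms
proof (induction d arbitrary: k c)
  case 0
  then obtain k' where "k = Suc k'" by (cases k) auto
  then show ?case using alternating_binomial_sum_Suc[of k' "\<lambda>_. 1"] by simp
next
  case (Suc d)
  then obtain k' where k: "k = Suc k'" "d < k'" by (cases k) auto
  let ?p = "\<lambda>l. \<Prod>i<d. c i + of_nat l"
  have "(\<Sum>l\<le>k. (- 1) ^ l * of_nat (k choose l) * (\<Prod>i<Suc d. c i + of_nat l))
    = c d * (\<Sum>l\<le>k. (- 1) ^ l * of_nat (k choose l) * ?p l)
      + (\<Sum>l\<le>k. (- 1) ^ l * (of_nat l * of_nat (k choose l)) * ?p l)"
    by (simp add: sum_distrib_left algebra_simps flip: sum.distrib)
  also have "(\<Sum>l\<le>k. (- 1) ^ l * of_nat (k choose l) * ?p l) = 0"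
    using Suc by simp
  also have "(\<Sum>l\<le>k. (- 1) ^ l * (of_nat l * of_nat (k choose l)) * ?p l)
    = (\<Sum>l\<le>k'. - (of_nat k * ((- 1) ^ l * of_nat (k' choose l) * (\<Prod>i<d. (c i + 1) + of_nat l))))"
  proof -
    have "of_nat (Suc l) * of_nat (k choose Suc l) = (of_nat k * of_nat (k' choose l) :: 'a)" for l
      unfolding k of_nat_mult[symmetric] by (simp only: Suc_times_binomial)
    note * = this
    show ?thesis
      unfolding k(1) sum.atMost_Suc_shift
      unfolding k(1)[symmetric] * by (simp add: mult_ac add_ac)
  qed
  also have "\<dots> = 0"
    using Suc.IH[OF k(2), of "\<lambda>i. c i + 1"] by (simp add: sum_negf sum_distrib_left[symmetric])
  finally show ?case by simp
qed

text \<open>This is the partial fraction decomposition of the right-hand side in \<open>a\<close>.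
  One difference step reduces it to the same sum for \<open>a\<close> and for
  \<open>a + 1\<close>.\<close>

lemma alternating_binomial_sum_inverse:
  fixes a :: "'a::field_char_0"
  assumes "\<And>l. a + of_nat l \<noteq> 0"
  shows "(\<Sum>l\<le>k. (- 1) ^ l * of_nat (k choose l) / (a + of_nat l)) = fact k / pochhammer a (Suc k)"
  using assms
proof (induction k arbitrary: a)
  case 0
  then show ?case by simp
next
  case (Suc k)
  have n1: "a + 1 + of_nat l \<noteq> 0" for l
    using Suc.prems[of "Suc l"] by (simp add: add_ac)
  have nz: "a \<noteq> 0" "a + of_nat (Suc k) \<noteq> 0" using Suc.prems[of 0] Suc.prems[of "Suc k"] by simp_all
  have p: "pochhammer (a + 1) k \<noteq> 0"
    using n1 by (metis add.commute add.right_inverse pochhammer_eq_0_iff)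
  have e3: "pochhammer (a + 1) (Suc k) = pochhammer (a + 1) k * (a + of_nat (Suc k))"
    by (simp only: pochhammer_Suc of_nat_Suc add_ac)
  have e1: "pochhammer a (Suc (Suc k)) = a * pochhammer (a + 1) k * (a + of_nat (Suc k))"
    by (simp only: pochhammer_rec[of a] e3 mult.assoc)
  have e2: "pochhammer a (Suc k) = a * pochhammer (a + 1) k"
    by (simp add: pochhammer_rec)
  have "(\<Sum>l\<le>Suc k. (- 1) ^ l * of_nat (Suc k choose l) / (a + of_nat l))
    = fact k / pochhammer a (Suc k) - fact k / pochhammer (a + 1) (Suc k)"
    using alternating_binomial_sum_Suc[of k "\<lambda>l. 1 / (a + of_nat l)"] Suc.IH[OF Suc.prems] Suc.IH[OF n1]
    by (simp add: add_ac)
  also have "\<dots> = fact (Suc k) / pochhammer a (Suc (Suc k))"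
    unfolding e1 e2 e3 using nz p by (simp add: divide_simps) (simp add: algebra_simps)
  finally show ?case .
qed

text \<open>Write the last factor as \<open>(c d - a) + (a + l)\<close>: the second part cancels the
  denominator and leaves a polynomial of degree below \<open>k\<close>, whose difference is 0. In
  effect the product is evaluated at the pole \<open>l = - a\<close>.\<close>

lemma alternating_binomial_sum_prod_divide:
  fixes a :: "'a::field_char_0"
  assumes "\<And>l. a + of_nat l \<noteq> 0" and "d \<le> k"
  shows "(\<Sum>l\<le>k. (- 1) ^ l * of_nat (k choose l) * (\<Prod>i<d. c i + of_nat l) / (a + of_nat l))
    = (\<Prod>i<d. c i - a) * fact k / pochhammer a (Suc k)"
  using assms(2)
proof (induction d)
  case 0
  then show ?case using alternating_binomial_sum_inverse[OF assms(1), of k] by simp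
next
  case (Suc d)
  let ?p = "\<lambda>l. \<Prod>i<d. c i + of_nat l"
  have "(\<Sum>l\<le>k. (- 1) ^ l * of_nat (k choose l) * (\<Prod>i<Suc d. c i + of_nat l) / (a + of_nat l))
    = (\<Sum>l\<le>k. (c d - a) * ((- 1) ^ l * of_nat (k choose l) * ?p l / (a + of_nat l))
               + (- 1) ^ l * of_nat (k choose l) * ?p l)"
    using assms(1) by (intro sum.cong refl) (simp add: field_simps)
  also have "\<dots> = (c d - a) * ((\<Prod>i<d. c i - a) * fact k / pochhammer a (Suc k))"
    using Suc alternating_binomial_sum_prod[of d k c]
    by (simp only: sum.distrib sum_distrib_left[symmetric]) simp
  finally show ?case by simp
qed

section \<open>Moments of the Gegenbauer weight\<close>

lemma pochhammer_shift_nonzero: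
  assumes "\<And>l. a + real l \<noteq> 0"
  shows "pochhammer a l \<noteq> 0"
  using assms by (metis add.right_inverse add.commute pochhammer_eq_0_iff)

lemma pochhammer_half_nonzero:
  assumes "\<And>l. 2 * lam + 1 + real l \<noteq> 0"
  shows "pochhammer (lam + 1/2) l \<noteq> 0"
proof (rule pochhammer_shift_nonzero)
  show "lam + 1/2 + real i \<noteq> 0" for i
    using assms[of "2 * i"] by simp
qed

text \<open>The moment of \<open>((1 - y) / 2) ^ l\<close> for the normalized weight \<open>(1 - y\<^sup>2) powr (lam - 1/2)\<close>, which makes sense
  also when that weight is not integrable.\<close>

definition jacobi_moment :: "real \<Rightarrow> nat \<Rightarrow> real" where
  "jacobi_moment lam l = pochhammer (lam + 1/2) l / pochhammer (2 * lam + 1) l"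

text \<open>The moment of \<open>(y - x) ^ k * s ^ j\<close>, where \<open>s = (1 - y) / 2\<close>.\<close>

definition shifted_moment :: "real \<Rightarrow> real \<Rightarrow> nat \<Rightarrow> nat \<Rightarrow> real" where
  "shifted_moment lam x k j =
     (\<Sum>l\<le>k. of_nat (k choose l) * (1 - x) ^ (k - l) * (- 2) ^ l * jacobi_moment lam (l + j))"

text \<open>The coefficient of (y - x)^i in C_k^(lam)(y), which is the entry of the triangular
  matrix A. The case distinction matters: for \<open>i > k\<close> the truncated
  \<open>k - i\<close> would select the leading coefficient 1 of the series.\<close>

definition gegenbauer_taylor_coeff :: "real \<Rightarrow> real \<Rightarrow> nat \<Rightarrow> nat \<Rightarrow> real" where
  "gegenbauer_taylor_coeff lam x k i =
     (if i \<le> k then 2 ^ i * pochhammer lam i / fact i * fps_nth (gegenbauer_fps (lam + real i) x) (k - i)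
      else 0)"

text \<open>The moment of \<open>C\<^sub>k(y) * s ^ j\<close>, with \<open>C\<^sub>k\<close> expanded at \<open>y = 1\<close>, where \<open>y - 1 = - 2 * s\<close>.\<close>

definition gegenbauer_moment :: "real \<Rightarrow> nat \<Rightarrow> nat \<Rightarrow> real" where
  "gegenbauer_moment lam k j =
     (\<Sum>l\<le>k. gegenbauer_taylor_coeff lam 1 k l * (- 2) ^ l * jacobi_moment lam (l + j))"

text \<open>A change of base point from 1 to \<open>x\<close>; the right-hand side is (A M)_(k,j).
  Each Taylor coefficient at 1 is itself expanded at \<open>x\<close> with increment
  \<open>1 - x\<close>, and sorting by the total order \<open>l + i\<close> rebuilds the binomial
  expansions of the powers of (1 - x) - 2s.\<close>

lemma gegenbauer_moment_eq_sum:
  "gegenbauer_moment lam k j = (\<Sum>i\<le>k. gegenbauer_taylor_coeff lam x k i * shifted_moment lam x i j)"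
proof -
  let ?C = "\<lambda>i k. fps_nth (gegenbauer_fps (lam + real i) x) k"
  let ?g = "\<lambda>l i. 2 ^ (l + i) * pochhammer lam (l + i) / fact (l + i) * ?C (l + i) (k - (l + i))
      * (of_nat (l + i choose l) * (1 - x) ^ i * (- 2) ^ l * jacobi_moment lam (l + j))"
  have "gegenbauer_moment lam k j = (\<Sum>l\<le>k. \<Sum>i\<le>k - l. ?g l i)"
    unfolding gegenbauer_moment_def
  proof (intro sum.cong refl)
    fix l assume "l \<in> {..k}"
    then have l: "l \<le> k" by simp
    have t: "2 ^ l * pochhammer lam l / fact l * (2 ^ i * pochhammer (lam + real l) i / fact i)
        = 2 ^ (l + i) * pochhammer lam (l + i) / fact (l + i) * of_nat (l + i choose l)" for i
      by (simp add: power_add pochhammer_product' binomial_fact[of l "l + i"])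
    have "gegenbauer_taylor_coeff lam 1 k l = 2 ^ l * pochhammer lam l / fact l
       * fps_nth (gegenbauer_fps (lam + real l) (x + (1 - x))) (k - l)"
      using l by (simp add: gegenbauer_taylor_coeff_def)
    also have "\<dots> = (\<Sum>i\<le>k - l. (2 ^ l * pochhammer lam l / fact l * (2 ^ i * pochhammer (lam + real l) i / fact i))
       * ((1 - x) ^ i * ?C (l + i) (k - (l + i))))"
      by (subst gegenbauer_taylor) (simp add: sum_distrib_left mult_ac add_ac diff_diff_left)
    finally have e: "gegenbauer_taylor_coeff lam 1 k l = \<dots>" .
    show "gegenbauer_taylor_coeff lam 1 k l * (- 2) ^ l * jacobi_moment lam (l + j) = (\<Sum>i\<le>k - l. ?g l i)"
      unfolding e t by (simp only: sum_distrib_right sum_distrib_left mult_ac)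
  qed
  also have "\<dots> = (\<Sum>(l, i)\<in>{(l, i). l + i \<le> k}. ?g l i)"
    by (subst sum.Sigma) (auto intro!: sum.cong)
  also have "\<dots> = (\<Sum>i\<le>k. \<Sum>l\<le>i. ?g l (i - l))"
    by (rule sum.triangle_reindex_eq)
  also have "\<dots> = (\<Sum>i\<le>k. gegenbauer_taylor_coeff lam x k i * shifted_moment lam x i j)"
    by (intro sum.cong refl)
      (auto simp: gegenbauer_taylor_coeff_def shifted_moment_def sum_distrib_left intro!: sum.cong)
  finally show ?thesis .
qed

text \<open>The duplication formula for \<open>pochhammer (2 * lam) (2 * l)\<close> absorbs the
  factor \<open>pochhammer (lam + 1/2) l\<close> of the moment. What is left beside the signed
  binomial coefficient is a function of \<open>l\<close> to which the difference lemmas apply when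
  \<open>j \<le> k\<close>.\<close>

lemma gegenbauer_moment_alternating:
  assumes nz: "\<And>l. 2 * lam + 1 + real l \<noteq> 0"
  shows "gegenbauer_moment lam k j = (\<Sum>l\<le>k. (- 1) ^ l * of_nat (k choose l) / fact k
     * (pochhammer (2 * lam) (k + l) / pochhammer (2 * lam + 1) (l + j))
     * pochhammer (lam + 1/2 + real l) j)"
  unfolding gegenbauer_moment_def
proof (intro sum.cong refl)
  fix l assume "l \<in> {..k}"
  then have l: "l \<le> k" by simp
  have p: "pochhammer (lam + 1/2) l \<noteq> 0"
    by (rule pochhammer_half_nonzero[OF nz])
  have d: "pochhammer (2 * lam) (k + l)
     = 2 ^ l * 2 ^ l * pochhammer lam l * pochhammer (lam + 1/2) l * pochhammer (2 * lam + 2 * real l) (k - l)"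
  proof -
    have "k + l = 2 * l + (k - l)" using l by simp
    then have "pochhammer (2 * lam) (k + l) = pochhammer (2 * lam) (2 * l) * pochhammer (2 * lam + real (2 * l)) (k - l)"
      by (metis pochhammer_product')
    moreover have "(4 :: real) ^ l = 2 ^ l * 2 ^ l" by (simp flip: power_mult_distrib)
    ultimately show ?thesis by (simp add: pochhammer_double power_mult)
  qed
  have q: "pochhammer (lam + 1/2) (l + j) = pochhammer (lam + 1/2) l * pochhammer (lam + 1/2 + real l) j"
    by (rule pochhammer_product')
  have b: "of_nat (k choose l) / fact k = 1 / (fact l * fact (k - l) :: real)"
    using l by (simp add: binomial_fact)
  have m: "(- 2 :: real) ^ l = (- 1) ^ l * 2 ^ l" by (simp add: power_mult_distrib[symmetric])
  have "gegenbauer_taylor_coeff lam 1 k l * (- 2) ^ l * jacobi_moment lam (l + j)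
     = (- 1) ^ l * (1 / (fact l * fact (k - l)))
       * (2 ^ l * 2 ^ l * pochhammer lam l * pochhammer (2 * lam + 2 * real l) (k - l)
          * (pochhammer (lam + 1/2) l * pochhammer (lam + 1/2 + real l) j) / pochhammer (2 * lam + 1) (l + j))"
    using l by (simp add: gegenbauer_taylor_coeff_def gegenbauer_at_1 jacobi_moment_def m q mult_ac ring_distribs)
  also have "\<dots> = (- 1) ^ l * of_nat (k choose l) / fact k
     * (pochhammer (2 * lam) (k + l) / pochhammer (2 * lam + 1) (l + j))
     * pochhammer (lam + 1/2 + real l) j"
    unfolding b[symmetric] d by simp
  finally show "gegenbauer_taylor_coeff lam 1 k l * (- 2) ^ l * jacobi_moment lam (l + j) = \<dots>" .
qed

lemma pochhammer_lessThan: "pochhammer a n = (\<Prod>i<n. a + of_nat i)"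
  by (simp add: pochhammer_prod atLeast0LessThan)

lemma gegenbauer_moment_eq_0:
  assumes nz: "\<And>l. 2 * lam + 1 + real l \<noteq> 0" and "j < k"
  shows "gegenbauer_moment lam k j = 0"
proof -
  \<comment> \<open>The linear factors of the summand in \<open>l\<close>: the first
    \<open>j\<close> come from the symbol with base \<open>lam + 1/2 + l\<close>, the other
    \<open>k - 1 - j\<close> from the quotient of the two symbols. The degree \<open>k - 1\<close>
    is just below \<open>k\<close>.\<close>
  let ?c = "\<lambda>i. if i < j then lam + 1/2 + real i else 2 * lam + 1 + real i"
  note nz' = pochhammer_shift_nonzero[OF nz]
  have *: "pochhammer (2 * lam) (k + l) / pochhammer (2 * lam + 1) (l + j) * pochhammer (lam + 1/2 + real l) j
       = 2 * lam * (\<Prod>i<k - 1. ?c i + of_nat l)" for l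
  proof -
    obtain d where k: "k = Suc (j + d)" using \<open>j < k\<close> less_iff_Suc_add by auto
    have "pochhammer (2 * lam) (k + l) = 2 * lam * pochhammer (2 * lam + 1) ((l + j) + d)"
      unfolding k by (simp add: pochhammer_rec add_ac)
    also have "\<dots> = 2 * lam * pochhammer (2 * lam + 1) (l + j) * pochhammer (2 * lam + 1 + real (l + j)) d"
      by (simp only: pochhammer_product' mult.assoc)
    finally have 1: "pochhammer (2 * lam) (k + l) / pochhammer (2 * lam + 1) (l + j)
        = 2 * lam * pochhammer (2 * lam + 1 + real (l + j)) d"
      using nz'[of "l + j"] by simp
    have "(\<Prod>i<j + d. ?c i + of_nat l) = (\<Prod>i<j. ?c i + of_nat l) * (\<Prod>i<d. ?c (j + i) + of_nat l)"
      by (induction d) auto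
    also have "\<dots> = pochhammer (lam + 1/2 + real l) j * pochhammer (2 * lam + 1 + real (l + j)) d"
      by (simp add: pochhammer_lessThan add_ac)
    finally show ?thesis unfolding 1 by (simp add: k mult_ac)
  qed
  have "gegenbauer_moment lam k j
      = 2 * lam / fact k * (\<Sum>l\<le>k. (- 1) ^ l * of_nat (k choose l) * (\<Prod>i<k - 1. ?c i + of_nat l))"
    unfolding gegenbauer_moment_alternating[OF nz] mult.assoc * by (simp add: sum_distrib_left mult_ac)
  also have "\<dots> = 0"
    using \<open>j < k\<close> by (subst alternating_binomial_sum_prod) auto
  finally show ?thesis .
qed

text \<open>On the diagonal the quotient of Pochhammer symbols keeps one factor
  \<open>2 * lam + k + l\<close> in the denominator, so the sum is a difference with a single pole.
  These values form the diagonal of T.\<close>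

lemma gegenbauer_moment_same:
  assumes nz: "\<And>l. 2 * lam + real l \<noteq> 0"
  shows "gegenbauer_moment lam k k
    = (- 1) ^ k * pochhammer (2 * lam) k * jacobi_moment lam k / pochhammer (2 * lam + 1 + real k) k"
proof -
  let ?a = "2 * lam + real k"
  have nz1: "2 * lam + 1 + real l \<noteq> 0" for l
    using nz[of "Suc l"] by (simp add: add_ac)
  note nz' = pochhammer_shift_nonzero[OF nz1]
  have *: "pochhammer (2 * lam) (k + l) / pochhammer (2 * lam + 1) (l + k) = 2 * lam / (?a + real l)" for l
  proof -
    have "pochhammer (2 * lam) (k + l) * (2 * lam + real (k + l)) = 2 * lam * pochhammer (2 * lam + 1) (k + l)"
      by (metis pochhammer_Suc pochhammer_rec)
    then show ?thesis
      using nz'[of "k + l"] nz[of "k + l"] by (simp add: field_simps)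
  qed
  \<comment> \<open>The numerator at the pole \<open>l = - ?a\<close>; read backwards, the product
    is a symbol with base \<open>lam + 1/2\<close> up to sign.\<close>
  have neg: "(\<Prod>i<k. lam + 1/2 + real i - ?a) = (- 1) ^ k * pochhammer (lam + 1/2) k"
  proof -
    have "(\<Prod>i<k. lam + 1/2 + real i - ?a) = pochhammer ((- lam - 1/2) - of_nat k + 1) k"
      unfolding pochhammer_lessThan by (intro prod.cong refl) simp
    also have "\<dots> = (- 1) ^ k * pochhammer (- (- lam - 1/2)) k"
      by (rule pochhammer_minus')
    also have "- (- lam - 1/2) = lam + 1/2" by simp
    finally show ?thesis .
  qed
  have az: "?a + real l \<noteq> 0" for l
    using nz[of "k + l"] by (simp add: add_ac)
  have pl: "pochhammer (lam + 1/2 + real l) k = (\<Prod>i<k. (lam + 1/2 + real i) + of_nat l)" for l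
    unfolding pochhammer_lessThan by (simp add: add_ac)
  have "gegenbauer_moment lam k k = 2 * lam / fact k *
     (\<Sum>l\<le>k. (- 1) ^ l * of_nat (k choose l) * (\<Prod>i<k. (lam + 1/2 + real i) + of_nat l) / (?a + of_nat l))"
    unfolding gegenbauer_moment_alternating[OF nz1] * pl
    by (simp add: sum_distrib_left mult_ac add_ac)
  also have "\<dots> = 2 * lam * (- 1) ^ k * pochhammer (lam + 1/2) k / pochhammer ?a (Suc k)"
    unfolding alternating_binomial_sum_prod_divide[OF az order.refl] neg by simp
  also have "\<dots> = (- 1) ^ k * pochhammer (2 * lam) k * jacobi_moment lam k / pochhammer (2 * lam + 1 + real k) k"
  proof -
    have "2 * lam / ?a = pochhammer (2 * lam) k / pochhammer (2 * lam + 1) k"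
      using *[of 0] by simp
    moreover have "pochhammer ?a (Suc k) = ?a * pochhammer (2 * lam + 1 + real k) k"
      by (simp add: pochhammer_rec add_ac)
    moreover have "2 * lam * (- 1) ^ k * pochhammer (lam + 1/2) k / (?a * pochhammer (2 * lam + 1 + real k) k)
       = (2 * lam / ?a) * ((- 1) ^ k * pochhammer (lam + 1/2) k / pochhammer (2 * lam + 1 + real k) k)"
      by simp
    ultimately show ?thesis by (simp add: jacobi_moment_def)
  qed
  finally show ?thesis .
qed

section \<open>Determinants\<close>

lemma prod_list_diag_mat:
  "B \<in> carrier_mat r r \<Longrightarrow> prod_list (diag_mat B) = (\<Prod>k<r. B $$ (k, k))"
  by (simp add: prod_list_diag_prod atLeast0LessThan)

lemma permutes_atLeast0_less:
  "p permutes {0..<n} \<Longrightarrow> i < n \<Longrightarrow> p i < (n::nat)"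
  using permutes_in_image[of p "{0..<n}" i] by simp

lemma det_scale_rows_cols:
  fixes a :: "nat \<Rightarrow> nat \<Rightarrow> 'a::comm_ring_1"
  shows "Determinant.det (mat m m (\<lambda>(i, j). r i * c j * a i j))
    = (\<Prod>i<m. r i) * (\<Prod>j<m. c j) * Determinant.det (mat m m (\<lambda>(i, j). a i j))"
proof -
  have "(\<Prod>i=0..<m. r i * c (p i) * a i (p i)) = (\<Prod>i<m. r i) * (\<Prod>j<m. c j) * (\<Prod>i=0..<m. a i (p i))"
    if "p permutes {0..<m}" for p
    using prod.permute[OF that, of c] by (simp add: prod.distrib atLeast0LessThan o_def)
  then show ?thesis
    by (simp add: det_def'[of _ m] sum_distrib_left mult.left_commute permutes_atLeast0_less)
qed

text \<open>The reversal acts on rows and on columns, so its sign enters twice. Taking the constant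
  term numbers both in the order opposite to that in the minor of A.\<close>

lemma det_reverse_rows_cols:
  fixes a :: "nat \<Rightarrow> nat \<Rightarrow> 'a::comm_ring_1"
  shows "Determinant.det (mat n n (\<lambda>(i, j). a (n - 1 - i) (n - 1 - j)))
    = Determinant.det (mat n n (\<lambda>(i, j). a i j))"
proof -
  define p where "p i = (if i < n then n - 1 - i else i)" for i
  have p: "p permutes {0..<n}"
    by (rule bij_imp_permutes)
      (auto simp: p_def intro!: bij_betw_byWitness[where f' = p])
  have rows: "Determinant.det (mat n n (\<lambda>(i, j). b (p i) j)) = signof p * Determinant.det (mat n n (\<lambda>(i, j). b i j))"
    for b :: "nat \<Rightarrow> nat \<Rightarrow> 'a"
  proof -
    have "mat n n (\<lambda>(i, j). b (p i) j) = mat n n (\<lambda>(i, j). mat n n (\<lambda>(i, j). b i j) $$ (p i, j))"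
      by (rule eq_matI) (auto simp: p_def)
    then show ?thesis using Determinant.det_permute_rows[OF _ p, of "mat n n (\<lambda>(i, j). b i j)"] by simp
  qed
  have tr: "Determinant.det (mat n n (\<lambda>(i, j). b j i)) = Determinant.det (mat n n (\<lambda>(i, j). b i j))"
    for b :: "nat \<Rightarrow> nat \<Rightarrow> 'a"
  proof -
    have "mat n n (\<lambda>(i, j). b j i) = transpose_mat (mat n n (\<lambda>(i, j). b i j))"
      by (rule eq_matI) auto
    then show ?thesis by (metis Determinant.det_transpose mat_carrier)
  qed
  have "mat n n (\<lambda>(i, j). a (n - 1 - i) (n - 1 - j)) = mat n n (\<lambda>(i, j). a (p i) (p j))"
    by (rule eq_matI) (auto simp: p_def)
  then have "Determinant.det (mat n n (\<lambda>(i, j). a (n - 1 - i) (n - 1 - j)))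
      = signof p * Determinant.det (mat n n (\<lambda>(i, j). a i (p j)))"
    using rows[of "\<lambda>i j. a i (p j)"] by simp
  also have "Determinant.det (mat n n (\<lambda>(i, j). a i (p j))) = signof p * Determinant.det (mat n n (\<lambda>(i, j). a i j))"
    using rows[of "\<lambda>i j. a j i"] tr[of "\<lambda>i j. a i (p j)"] tr[of a] by simp
  also have "signof p * (signof p * Determinant.det (mat n n (\<lambda>(i, j). a i j))) = Determinant.det (mat n n (\<lambda>(i, j). a i j))"
    by (simp add: sign_def)
  finally show ?thesis .
qed

lemma det_complementary_minors:
  fixes a M :: "nat \<Rightarrow> nat \<Rightarrow> 'a::idom"
  assumes lower: "\<And>k i. k < i \<Longrightarrow> a k i = 0"
    and ortho: "\<And>k j. j < m \<Longrightarrow> j < k \<Longrightarrow> k < n + m \<Longrightarrow> (\<Sum>i<n + m. a k i * M i j) = 0"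
  shows "(\<Prod>k<n + m. a k k) * ((- 1) ^ (n * m) * Determinant.det (mat m m (\<lambda>(i, j). M (n + i) j)))
    = (\<Prod>j<m. \<Sum>i<n + m. a j i * M i j) * Determinant.det (mat n n (\<lambda>(i, j). a (m + i) j))"
proof -
  let ?N = "n + m"
  define A where "A = mat ?N ?N (\<lambda>(k, i). a k i)"
  define X where "X = mat ?N ?N (\<lambda>(i, j). if j < m then M i j else if i = j - m then 1 else 0)"
  define T where "T = mat m m (\<lambda>(k, j). \<Sum>i<?N. a k i * M i j)"
  have A: "A \<in> carrier_mat ?N ?N" and X: "X \<in> carrier_mat ?N ?N" by (auto simp: A_def X_def)
  have detA: "Determinant.det A = (\<Prod>k<?N. a k k)"
    by (subst det_lower_triangular[OF _ A]) (auto simp: A_def lower prod_list_diag_mat[of _ ?N])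
  have detT: "Determinant.det T = (\<Prod>j<m. \<Sum>i<?N. a j i * M i j)"
    by (subst det_upper_triangular[of _ m]) (auto simp: T_def ortho prod_list_diag_mat[of _ m])
  \<comment> \<open>Moving the \<open>n\<close> unit columns to the front produces the sign and
    makes the matrix block upper triangular, so the top rows of \<open>M\<close> drop out.\<close>
  have "Determinant.det X = (- 1) ^ (n * m)
      * Determinant.det (mat ?N ?N (\<lambda>(i, j). X $$ (i, if j < n then j + m else j - n)))"
    by (rule det_swap_cols[OF X])
  also have "mat ?N ?N (\<lambda>(i, j). X $$ (i, if j < n then j + m else j - n))
      = four_block_mat (1\<^sub>m n) (mat n m (\<lambda>(i, j). M i j)) (0\<^sub>m m n) (mat m m (\<lambda>(i, j). M (n + i) j))"
    by (rule eq_matI) (auto simp: X_def)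
  also have "Determinant.det \<dots> = Determinant.det (mat m m (\<lambda>(i, j). M (n + i) j))"
    by (subst det_four_block_mat_lower_left_zero[of _ n _ m]) auto
  finally have detX: "Determinant.det X = (- 1) ^ (n * m) * Determinant.det (mat m m (\<lambda>(i, j). M (n + i) j))" .
  have "A * X = four_block_mat T (mat m n (\<lambda>(k, j). a k j)) (0\<^sub>m n m) (mat n n (\<lambda>(i, j). a (m + i) j))"
  proof (rule eq_matI)
    fix k j
    assume "k < dim_row (four_block_mat T (mat m n (\<lambda>(k, j). a k j)) (0\<^sub>m n m) (mat n n (\<lambda>(i, j). a (m + i) j)))"
      and "j < dim_col (four_block_mat T (mat m n (\<lambda>(k, j). a k j)) (0\<^sub>m n m) (mat n n (\<lambda>(i, j). a (m + i) j)))"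
    then have kj: "k < ?N" "j < ?N" by (auto simp: T_def)
    have "(A * X) $$ (k, j) = (\<Sum>i<?N. a k i * (if j < m then M i j else if i = j - m then 1 else 0))"
      using kj by (auto simp: A_def X_def scalar_prod_def atLeast0LessThan intro!: sum.cong)
    also have "\<dots> = (if j < m then (\<Sum>i<?N. a k i * M i j) else a k (j - m))"
      using kj by (auto simp: if_distrib[of "(*) _"] cong: if_cong)
    also have "\<dots> = four_block_mat T (mat m n (\<lambda>(k, j). a k j)) (0\<^sub>m n m) (mat n n (\<lambda>(i, j). a (m + i) j)) $$ (k, j)"
      using kj ortho[of j k] by (auto simp: T_def)
    finally show "(A * X) $$ (k, j) = \<dots>" .
  qed (auto simp: A_def X_def T_def)
  then have "Determinant.det A * Determinant.det X
      = Determinant.det T * Determinant.det (mat n n (\<lambda>(i, j). a (m + i) j))"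
    by (subst det_mult[OF A X, symmetric], simp, subst det_four_block_mat_lower_left_zero[of _ m _ n])
      (auto simp: T_def)
  then show ?thesis by (simp only: detA detT detX)
qed

section \<open>Jacobi polynomials as moments\<close>

lemma poly_jacobi_num:
  "poly (jacobi_num k \<alpha> \<beta>) x = pochhammer (\<alpha> + 1) k / fact k *
    (\<Sum>j\<le>k. of_nat (k choose j) * (1 - x) ^ (k - j) * (- 2) ^ j
        * (pochhammer (real k + \<alpha> + \<beta> + 1) j / pochhammer (\<alpha> + 1) j))"
proof -
  define A where "A j = pochhammer (real k + \<alpha> + \<beta> + 1) j / pochhammer (\<alpha> + 1) j" for j
  let ?q = "smult (pochhammer (\<alpha> + 1) k / fact k)
              (\<Sum>j\<le>k. smult (of_nat (k choose j) * (- 2) ^ j * A j) ([:1, - 1:] ^ (k - j)))"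
  have "poly ?q y = (1 - y) ^ k * jacobi_P k \<alpha> \<beta> ((y + 3) / (y - 1))" if "y \<noteq> 1" for y :: real
  proof -
    \<comment> \<open>Together with the factor \<open>1 / 2 ^ j\<close> this yields
      \<open>(- 2) ^ j * (1 - y) ^ (k - j)\<close>, the pattern of
      \<open>shifted_moment\<close>.\<close>
    have Y: "(y + 3) / (y - 1) - 1 = (- 4) / (1 - y)"
      using that by (simp add: field_simps)
    have e: "(1 - y) ^ k * (1 / 2 ^ j * B * C * D * ((- 4) / (1 - y)) ^ j)
        = D * (- 2) ^ j * (B * C) * (1 - y) ^ (k - j)" if "j \<le> k" for j and B C D :: real
    proof -
      have "(- 4 :: real) ^ j = 2 ^ j * (- 2) ^ j" by (simp flip: power_mult_distrib)
      then show ?thesis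
        unfolding power_divide using \<open>y \<noteq> 1\<close> that by (simp add: power_diff)
    qed
    have "(1 - y) ^ k * jacobi_P k \<alpha> \<beta> ((y + 3) / (y - 1)) = pochhammer (\<alpha> + 1) k / fact k *
      (\<Sum>j\<le>k. (1 - y) ^ k * (1 / 2 ^ j * pochhammer (real k + \<alpha> + \<beta> + 1) j * inverse (pochhammer (\<alpha> + 1) j)
          * of_nat (k choose j) * ((- 4) / (1 - y)) ^ j))"
      unfolding jacobi_P_def Y atLeast0AtMost by (simp only: sum_distrib_left divide_inverse mult_ac)
    also have "\<dots> = pochhammer (\<alpha> + 1) k / fact k *
      (\<Sum>j\<le>k. of_nat (k choose j) * (- 2) ^ j * A j * (1 - y) ^ (k - j))"
      by (rule arg_cong[of _ _ "(*) (pochhammer (\<alpha> + 1) k / fact k)"], rule sum.cong)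
        (simp_all only: atMost_iff e A_def, simp_all add: divide_inverse)
    also have "\<dots> = poly ?q y"
      by (simp add: poly_sum poly_power)
    finally show ?thesis by simp
  qed
  then have "jacobi_num k \<alpha> \<beta> = ?q"
    unfolding jacobi_num_def by (intro the1_equality[OF jacobi_num_ex1]) auto
  then show ?thesis
    by (simp add: poly_sum poly_power A_def mult_ac)
qed

text \<open>The length n + i - j in the theorem is negative once j > n + i, where
  \<open>poch\<close> switches to Gamma; the quotient covers both cases. The condition on
  \<open>u\<close> keeps \<open>u + a\<close> off the poles of Gamma.\<close>

lemma poch_eq:
  assumes "\<And>i::nat. u + real i \<noteq> 0" and "int a = int b + l"
  shows "poch (u + real b) l = pochhammer u a / pochhammer u b"
proof (cases "0 \<le> l")
  case True
  then have "a = b + nat l" using assms(2) by simp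
  moreover have "pochhammer u b \<noteq> 0"
    using pochhammer_shift_nonzero[OF assms(1)] .
  ultimately show ?thesis using True by (simp add: poch_def pochhammer_product')
next
  case False
  define d where "d = nat (- l)"
  have b: "b = a + d" and l: "real_of_int l = - real d" using assms(2) False by (auto simp: d_def)
  have nz: "pochhammer u a \<noteq> 0" "pochhammer u b \<noteq> 0"
    using pochhammer_shift_nonzero[OF assms(1)] by auto
  have ni: "u + real a \<notin> \<int>\<^sub>\<le>\<^sub>0"
  proof
    assume "u + real a \<in> \<int>\<^sub>\<le>\<^sub>0"
    then obtain i where "u + real a = - real i" by (auto elim!: nonpos_Ints_cases')
    then show False using assms(1)[of "a + i"] by simp
  qed
  have e: "u + real b + real_of_int l = u + real a" by (simp add: l b)
  have "pochhammer (u + real a) d = Gamma (u + real b) / Gamma (u + real a)"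
    using pochhammer_Gamma[OF ni, of d] by (simp add: b add_ac)
  moreover have "pochhammer u b = pochhammer u a * pochhammer (u + real a) d"
    unfolding b by (rule pochhammer_product')
  ultimately show ?thesis
    using False nz by (simp add: poch_def e)
qed

text \<open>With \<open>k = n + i\<close>, the second parameter is such that
  \<open>k + \<alpha> + \<beta> + 1 = lam + 1/2 + j\<close> does not depend on the row. The
  coefficients are then moments shifted by \<open>j\<close>, and \<open>poch\<close> cancels the
  symbol of length \<open>n + i\<close> in front, leaving one factor per row and one per column.
  Here \<open>i\<close> and \<open>j\<close> count from 0.\<close>

lemma jacobi_entry:
  assumes nz: "\<And>l. 2 * lam + real l \<noteq> 0"
  shows "poly (jacobi_num (n + Suc i - 1) (2 * lam + real (Suc j) - 1) (- real n - real (Suc i) - lam + 1 / 2)) x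
           / poch (2 * lam + 2 * real (Suc j) - 1) (int n + int (Suc i) - int (Suc j))
    = 1 / fact (n + i) * (pochhammer (2 * lam + 1) (2 * j) / (pochhammer (2 * lam + 1) j * jacobi_moment lam j))
      * shifted_moment lam x (n + i) j"
proof -
  let ?k = "n + i" and ?u = "2 * lam + 1"
  have nz1: "?u + real l \<noteq> 0" for l
    using nz[of "Suc l"] by (simp add: add_ac)
  note pu = pochhammer_shift_nonzero[OF nz1] and ph = pochhammer_half_nonzero[OF nz1]
  have m: "pochhammer (lam + 1/2 + real j) l / pochhammer (?u + real j) l
      = jacobi_moment lam (l + j) / jacobi_moment lam j" for l
    unfolding jacobi_moment_def add.commute[of l j] pochhammer_product' using pu[of j] ph[of j] by simp
  have "poly (jacobi_num ?k (2 * lam + real j) (- real n - real (Suc i) - lam + 1 / 2)) x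
     = pochhammer (?u + real j) ?k / fact ?k * (shifted_moment lam x ?k j / jacobi_moment lam j)"
  proof -
    have "real ?k + (2 * lam + real j) + (- real n - real (Suc i) - lam + 1 / 2) + 1 = lam + 1/2 + real j"
      "2 * lam + real j + 1 = ?u + real j" by simp_all
    then show ?thesis
      unfolding poly_jacobi_num by (simp only: m shifted_moment_def sum_divide_distrib) (simp add: mult_ac)
  qed
  moreover have "poch (2 * lam + 2 * real (Suc j) - 1) (int n + int (Suc i) - int (Suc j))
      = pochhammer ?u (j + ?k) / pochhammer ?u (2 * j)"
    using poch_eq[of ?u "j + ?k" "2 * j" "int n + int (Suc i) - int (Suc j)", OF nz1] by (simp add: algebra_simps)
  moreover have "pochhammer ?u (j + ?k) = pochhammer ?u j * pochhammer (?u + real j) ?k"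
    by (rule pochhammer_product')
  ultimately show ?thesis using pu[of "j + ?k"] by (simp add: mult_ac)
qed

lemma sum_lessThan_eq_choose_2: "(\<Sum>j<m. j) = m choose 2"
  by (induction m) (auto simp: numeral_2_eq_2)

lemma det_gegenbauer_eq_det_jacobi:
  assumes nz: "\<And>l. 2 * lam + real l \<noteq> 0"
  shows "Determinant.det (mat n n (\<lambda>(i, j).
       if j \<le> m + i then fps_nth (gegenbauer_fps (lam + real j) x) (m + i - j) else 0))
    = (- 1) ^ (n * m + (m choose 2)) * 2 ^ (n * m + (m choose 2))
       * (\<Prod>j<m. pochhammer lam (n + j) / pochhammer (2 * lam) j)
       * det1 m (\<lambda>i j.
           poly (jacobi_num (n + i - 1) (2 * lam + real j - 1) (- real n - real i - lam + 1 / 2)) x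
           / poch (2 * lam + 2 * real j - 1) (int n + int i - int j))"
    (is "Determinant.det (mat n n ?W) = _")
proof -
  let ?N = "n + m"
  let ?a = "gegenbauer_taylor_coeff lam x"
  let ?M = "shifted_moment lam x"
  let ?dM = "Determinant.det (mat m m (\<lambda>(i, j). ?M (n + i) j))"
  \<comment> \<open>\<open>s j\<close> is both the diagonal entry of A and the scale of column
    \<open>j\<close> in its minor; after cancellation only \<open>s n, ..., s (n + m - 1)\<close>
    remain.\<close>
  define s where "s j = 2 ^ j * pochhammer lam j / fact j" for j
  define d where "d j = pochhammer (2 * lam + 1) (2 * j) / (pochhammer (2 * lam + 1) j * jacobi_moment lam j)" for j
  define \<tau> where "\<tau> = (\<lambda>j. gegenbauer_moment lam j j)"
  have nz1: "2 * lam + 1 + real l \<noteq> 0" for l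
    using nz[of "Suc l"] by (simp add: add_ac)
  have p0: "pochhammer lam l \<noteq> 0" "pochhammer (2 * lam) l \<noteq> 0" "pochhammer (2 * lam + 1) l \<noteq> 0"
    "pochhammer (lam + 1/2) l \<noteq> 0" for l
  proof -
    have "lam + real i \<noteq> 0" for i using nz[of "2 * i"] by simp
    then show "pochhammer lam l \<noteq> 0" by (rule pochhammer_shift_nonzero)
  qed (rule pochhammer_shift_nonzero[OF nz] pochhammer_shift_nonzero[OF nz1] pochhammer_half_nonzero[OF nz1])+
  have sum_eq: "(\<Sum>i<?N. ?a k i * ?M i j) = gegenbauer_moment lam k j" if "k < ?N" for k j
    unfolding gegenbauer_moment_eq_sum[of lam k j x] using that
    by (intro sum.mono_neutral_right) (auto simp: gegenbauer_taylor_coeff_def)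
  have "(\<Prod>k<?N. ?a k k) * ((- 1) ^ (n * m) * ?dM)
      = (\<Prod>j<m. \<Sum>i<?N. ?a j i * ?M i j) * Determinant.det (mat n n (\<lambda>(i, j). ?a (m + i) j))"
  proof (rule det_complementary_minors)
    fix k j assume "j < m" "j < k" "k < ?N"
    then show "(\<Sum>i<?N. ?a k i * ?M i j) = 0"
      using gegenbauer_moment_eq_0[OF nz1] by (simp add: sum_eq)
  qed (simp add: gegenbauer_taylor_coeff_def)
  also have "(\<Prod>j<m. \<Sum>i<?N. ?a j i * ?M i j) = (\<Prod>j<m. \<tau> j)"
    by (intro prod.cong refl) (simp add: sum_eq \<tau>_def)
  also have "mat n n (\<lambda>(i, j). ?a (m + i) j) = mat n n (\<lambda>(i, j). 1 * s j * (?W (i, j)))"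
    by (rule eq_matI) (auto simp: gegenbauer_taylor_coeff_def s_def)
  also have "Determinant.det \<dots> = (\<Prod>j<n. s j) * Determinant.det (mat n n ?W)"
    by (subst det_scale_rows_cols) simp
  also have "(\<Prod>k<?N. ?a k k) = (\<Prod>k<n. s k) * (\<Prod>j<m. s (n + j))"
  proof -
    have "?a k k = s k" for k
      by (simp add: gegenbauer_taylor_coeff_def s_def gegenbauer_fps_def)
    moreover have "(\<Prod>k<n + m. s k) = (\<Prod>k<n. s k) * (\<Prod>j<m. s (n + j))"
      by (induction m) auto
    ultimately show ?thesis by simp
  qed
  finally have main: "(\<Prod>j<m. s (n + j)) * ((- 1) ^ (n * m) * ?dM) = (\<Prod>j<m. \<tau> j) * Determinant.det (mat n n ?W)"
    using p0 by (simp add: s_def)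
  \<comment> \<open>The column factor \<open>d j\<close> of the Jacobi matrix reappears in the
    inverse of \<open>\<tau> j\<close>, so the moment determinant turns into \<open>det1\<close>.
    What remains is a sign and the denominator \<open>pochhammer (2 * lam) j\<close> of the
    theorem.\<close>
  have \<tau>: "\<tau> j \<noteq> 0" "inverse (\<tau> j) = (- 1) ^ j / pochhammer (2 * lam) j * d j" for j
  proof -
    have "pochhammer (2 * lam + 1) (j + j) = pochhammer (2 * lam + 1) j * pochhammer (2 * lam + 1 + real j) j"
      by (rule pochhammer_product')
    then have t: "\<tau> j = (- 1) ^ j * pochhammer (2 * lam) j / d j" 
      using p0 unfolding \<tau>_def gegenbauer_moment_same[OF nz] d_def
      by (simp add: mult_2[symmetric])
    have d0: "d j \<noteq> 0"
      using p0 by (simp add: d_def jacobi_moment_def)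
    show "\<tau> j \<noteq> 0" using t p0 d0 by simp
    have "((- 1 :: real) ^ j) * (- 1) ^ j = 1" by (simp flip: power_mult_distrib)
    then show "inverse (\<tau> j) = (- 1) ^ j / pochhammer (2 * lam) j * d j"
      unfolding t using p0 d0 by (simp add: field_simps)
  qed
  have det1: "det1 m (\<lambda>i j.
           poly (jacobi_num (n + i - 1) (2 * lam + real j - 1) (- real n - real i - lam + 1 / 2)) x
           / poch (2 * lam + 2 * real j - 1) (int n + int i - int j))
     = (\<Prod>i<m. 1 / fact (n + i)) * (\<Prod>j<m. d j) * ?dM"
    unfolding det1_def jacobi_entry[OF nz] d_def[symmetric] by (rule det_scale_rows_cols)
  have pw: "(\<Prod>j<m. (2::real) ^ (n + j)) = 2 ^ (n * m + (m choose 2))"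
    by (simp add: power_sum[symmetric] sum.distrib sum_lessThan_eq_choose_2 mult.commute)
  have sg: "(\<Prod>j<m. (- 1::real) ^ j) = (- 1) ^ (m choose 2)"
    by (simp add: power_sum[symmetric] sum_lessThan_eq_choose_2)
  have "(\<Prod>j<m. \<tau> j) \<noteq> 0" using \<tau>(1) by simp
  then have "Determinant.det (mat n n ?W) = inverse (\<Prod>j<m. \<tau> j) * ((\<Prod>j<m. s (n + j)) * ((- 1) ^ (n * m) * ?dM))"
    unfolding main by simp
  also have "inverse (\<Prod>j<m. \<tau> j) = (\<Prod>j<m. (- 1) ^ j) * (\<Prod>j<m. 1 / pochhammer (2 * lam) j) * (\<Prod>j<m. d j)"
    by (simp add: prod_inversef[symmetric] o_def \<tau>(2) prod.distrib[symmetric])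
  also have "(\<Prod>j<m. s (n + j)) = (\<Prod>j<m. 2 ^ (n + j)) * (\<Prod>j<m. pochhammer lam (n + j)) * (\<Prod>j<m. 1 / fact (n + j))"
    by (simp add: s_def prod.distrib[symmetric])
  finally show ?thesis
    unfolding det1 pw sg by (simp add: prod_dividef power_add)
qed

section \<open>Laurent expansions and constant terms\<close>

lemma has_sum_sum_finite:
  fixes f :: "'i \<Rightarrow> 'a \<Rightarrow> 'b::topological_comm_monoid_add"
  assumes "\<And>i. i \<in> S \<Longrightarrow> (f i has_sum s i) A"
  shows "((\<lambda>k. \<Sum>i\<in>S. f i k) has_sum (\<Sum>i\<in>S. s i)) A"
  using assms
proof (induction S rule: infinite_finite_induct)
  case (insert x F)
  then show ?case by (simp add: has_sum_add)
qed auto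

text \<open>Summable complex families are absolutely summable, so the norms are summable over the
  product set, and the sum can be taken one coordinate at a time.\<close>

lemma has_sum_prod_PiE:
  fixes f :: "'i \<Rightarrow> 'a \<Rightarrow> complex"
  assumes "finite A" and "\<And>j. j \<in> A \<Longrightarrow> (f j has_sum s j) (B j)"
  shows "((\<lambda>k. \<Prod>j\<in>A. f j (k j)) has_sum (\<Prod>j\<in>A. s j)) (PiE A B)"
  using assms
proof (induction A rule: finite_induct)
  case empty
  then show ?case by (simp add: has_sum_finite_iff)
next
  case (insert x A)
  let ?F = "\<lambda>k. \<Prod>j\<in>A. f j (k j)"
  have F: "(?F has_sum (\<Prod>j\<in>A. s j)) (PiE A B)" and x: "(f x has_sum s x) (B x)"
    using insert by auto
  have nF: "(\<lambda>k. norm (?F k)) summable_on PiE A B" and nx: "(\<lambda>y. norm (f x y)) summable_on B x"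
    using F[THEN has_sum_imp_summable] x[THEN has_sum_imp_summable]
    by (simp_all only: summable_on_iff_abs_summable_on_complex)
  have "((\<lambda>y. norm (?F k * f x y)) has_sum (norm (?F k) * infsum (\<lambda>y. norm (f x y)) (B x))) (B x)" for k
    unfolding norm_mult using nx by (intro has_sum_cmult_right has_sum_infsum)
  note norm_sum = this
  have "(\<lambda>p. norm (?F (fst p) * f x (snd p))) summable_on (PiE A B \<times> B x)"
    by (rule summable_on_SigmaI[where g = "\<lambda>k. norm (?F k) * infsum (\<lambda>y. norm (f x y)) (B x)"])
      (simp_all only: fst_conv snd_conv norm_sum norm_ge_zero summable_on_cmult_left[OF nF])
  then have "(\<lambda>p. ?F (fst p) * f x (snd p)) summable_on (PiE A B \<times> B x)"
    by (rule abs_summable_summable)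
  then have "((\<lambda>p. ?F (fst p) * f x (snd p)) has_sum ((\<Prod>j\<in>A. s j) * s x)) (PiE A B \<times> B x)"
    by (intro has_sum_SigmaI[where g = "\<lambda>k. ?F k * s x"])
      (simp_all only: fst_conv snd_conv has_sum_cmult_right[OF x] has_sum_cmult_left[OF F])
  then have "((\<lambda>(k, y). ?F k * f x y) has_sum ((\<Prod>j\<in>A. s j) * s x)) (PiE A B \<times> B x)"
    by (simp only: case_prod_unfold)
  moreover have "(\<lambda>(k, y). ?F k * f x y)
      = (\<lambda>k. \<Prod>j\<in>insert x A. f j (k j)) \<circ> (\<lambda>(g, y). g(x := y))"
  proof -
    have "?F (g(x := y)) = ?F g" for g y
      using insert.hyps by (intro prod.cong) auto
    then show ?thesis
      using insert.hyps by (auto simp: fun_eq_iff mult.commute)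
  qed
  ultimately have "((\<lambda>k. \<Prod>j\<in>insert x A. f j (k j)) has_sum ((\<Prod>j\<in>A. s j) * s x))
      ((\<lambda>(g, y). g(x := y)) ` (PiE A B \<times> B x))"
    by (subst has_sum_reindex[OF inj_combinator'[OF insert.hyps(2)]]) simp
  moreover have "(\<lambda>(g, y). g(x := y)) ` (PiE A B \<times> B x) = PiE (insert x A) B"
    unfolding PiE_insert_eq by (subst swap_product[symmetric]) (simp add: image_image case_prod_unfold)
  ultimately show ?case
    using insert.hyps by (simp add: mult.commute)
qed

lemma sum_roots_of_unity_power_int:
  fixes k :: int
  assumes "\<bar>k\<bar> < int N" and "k \<noteq> 0"
  shows "(\<Sum>a<N. (cis (2 * pi / real N) ^ a) powi k) = 0"
proof -
  let ?w = "cis (2 * pi / real N) powi k"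
  have N: "N > 0" using assms by auto
  have "?w \<noteq> 1"
  proof
    assume "?w = 1"
    then obtain i :: int where "of_int k * (2 * pi / real N) = of_int i * (2 * pi)"
      by (auto simp: cis_power_int cis_eq_1_iff)
    then have "of_int k = (of_int i * real N :: real)" using N by (simp add: field_simps)
    then have "k = i * int N" by (metis of_int_eq_iff of_int_mult of_int_of_nat_eq)
    then show False
      using assms by (metis abs_mult abs_of_nat dvd_triv_right zdvd_not_zless zero_less_abs_iff abs_dvd_iff dvd_abs_iff)
  qed
  moreover have "?w ^ N = 1"
  proof -
    have "?w ^ N = cis (real N * (of_int k * (2 * pi / real N)))"
      by (simp only: cis_power_int Complex.DeMoivre)
    also have "real N * (of_int k * (2 * pi / real N)) = of_int k * (2 * pi)" using N by simp
    finally show ?thesis by (simp add: cis_eq_1_iff)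
  qed
  moreover have "(cis (2 * pi / real N) ^ a) powi k = ?w ^ a" for a
    by (simp add: cis_power_int Complex.DeMoivre algebra_simps)
  ultimately show ?thesis by (simp add: sum_gp_strict)
qed

text \<open>Averaging over the \<open>N\<close>-th roots of unity in each variable kills every term with an exponent in
  \<open>{- N <..< N} - {0}\<close>; the remaining terms other than the constant one lie in an arbitrarily small tail.\<close>

lemma Laurent_constant_coeff_unique:
  assumes "has_Laurent_expansion_at_0 n F c" and "has_Laurent_expansion_at_0 n F c'"
  shows "c (\<lambda>j\<in>{1..n}. 0) = c' (\<lambda>j\<in>{1..n}. 0)"
proof (rule ccontr)
  let ?I = "{1..n}"
  let ?K = "?I \<rightarrow>\<^sub>E (UNIV :: int set)" and ?o = "\<lambda>j\<in>?I. 0 :: int"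
  assume ne: "c ?o \<noteq> c' ?o"
  define d where "d k = c k - c' k" for k
  obtain r r' where r: "r > 0" "\<And>z. (\<forall>j\<in>?I. z j \<noteq> 0 \<and> norm (z j) < r) \<Longrightarrow>
      ((\<lambda>k. c k * (\<Prod>j=1..n. z j powi k j)) has_sum F z) ?K"
    and r': "r' > 0" "\<And>z. (\<forall>j\<in>?I. z j \<noteq> 0 \<and> norm (z j) < r') \<Longrightarrow>
      ((\<lambda>k. c' k * (\<Prod>j=1..n. z j powi k j)) has_sum F z) ?K"
    using assms unfolding has_Laurent_expansion_at_0_def by auto
  define \<rho> where "\<rho> = min r r' / 2"
  have \<rho>: "\<rho> > 0" "\<rho> < r" "\<rho> < r'" using r(1) r'(1) by (auto simp: \<rho>_def)
  have z: "((\<lambda>k. d k * (\<Prod>j=1..n. z j powi k j)) has_sum 0) ?K" if "\<And>j. j \<in> ?I \<Longrightarrow> norm (z j) = \<rho>" for z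
  proof -
    have "z j \<noteq> 0 \<and> norm (z j) < r" "z j \<noteq> 0 \<and> norm (z j) < r'" if "j \<in> ?I" for j
      using that \<rho> \<open>\<And>j. j \<in> ?I \<Longrightarrow> norm (z j) = \<rho>\<close>[of j] by auto
    then show ?thesis
      using has_sum_add[OF r(2)[of z] has_sum_cmult_right[OF r'(2)[of z], of "- 1"]]
      by (simp add: d_def left_diff_distrib)
  qed
  \<comment> \<open>The norm of a term depends only on the moduli of the coordinates, so
    \<open>b\<close> bounds it on the whole torus of radius \<open>\<rho>\<close> and also bounds
    its averages.\<close>
  define b where "b k = norm (d k * (\<Prod>j=1..n. complex_of_real \<rho> powi k j))" for k
  have "(\<lambda>k. d k * (\<Prod>j=1..n. complex_of_real \<rho> powi k j)) summable_on ?K"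
    using z[of "\<lambda>_. complex_of_real \<rho>"] \<rho> by (auto simp: summable_on_def)
  then have "b summable_on ?K"
    unfolding b_def by (simp only: summable_on_iff_abs_summable_on_complex)
  then obtain B where B: "(b has_sum B) ?K" by (auto simp: summable_on_def)
  define \<epsilon> where "\<epsilon> = norm (d ?o) / 2"
  have "\<epsilon> > 0" using ne by (simp add: \<epsilon>_def d_def)
  obtain S where S: "finite S" "S \<subseteq> ?K" "dist (sum b S) B \<le> \<epsilon>"
    using has_sum_finite_approximation[OF B \<open>\<epsilon> > 0\<close>] by blast
  define S' where "S' = insert ?o S"
  have S': "finite S'" "S' \<subseteq> ?K" using S by (auto simp: S'_def)
  have "sum b S \<le> sum b S'"
    using S by (intro sum_mono2) (auto simp: S'_def b_def)
  then have tail: "B - sum b S' \<le> \<epsilon>" using S(3) by (simp add: dist_real_def)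
  define N where "N = Suc (\<Sum>k\<in>S. \<Sum>j\<in>?I. nat \<bar>k j\<bar>)"
  have N: "\<bar>k j\<bar> < int N" if "k \<in> S" "j \<in> ?I" for k j
  proof -
    have "nat \<bar>k j\<bar> \<le> (\<Sum>j\<in>?I. nat \<bar>k j\<bar>)" using that by (intro member_le_sum) auto
    also have "\<dots> \<le> (\<Sum>k\<in>S. \<Sum>j\<in>?I. nat \<bar>k j\<bar>)"
      using that S(1) by (intro member_le_sum[of k S "\<lambda>k. \<Sum>j\<in>?I. nat \<bar>k j\<bar>"]) auto
    finally have "nat \<bar>k j\<bar> < N" by (simp only: N_def less_Suc_eq_le)
    then show ?thesis by linarith
  qed
  define w where "w = cis (2 * pi / real N)"
  have nw: "norm ((w ^ a) powi k) = 1" for a k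
    by (simp add: w_def norm_power_int norm_power)
  define g where "g k = d k * (\<Prod>j=1..n. complex_of_real \<rho> powi k j) * (\<Prod>j=1..n. (\<Sum>a<N. (w ^ a) powi k j) / of_nat N)" for k
  have "N > 0" by (simp add: N_def)
  then have N0: "(of_nat N :: complex) \<noteq> 0" by simp
  have "((\<lambda>k. \<Sum>\<theta>\<in>?I \<rightarrow>\<^sub>E {..<N}. d k * (\<Prod>j=1..n. (complex_of_real \<rho> * w ^ \<theta> j) powi k j))
      has_sum (\<Sum>\<theta>\<in>?I \<rightarrow>\<^sub>E {..<N}. 0)) ?K"
    using \<rho> by (intro has_sum_sum_finite z) (simp add: norm_mult norm_power w_def)
  moreover have "(\<Sum>\<theta>\<in>?I \<rightarrow>\<^sub>E {..<N}. d k * (\<Prod>j=1..n. (complex_of_real \<rho> * w ^ \<theta> j) powi k j))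
      = of_nat N ^ n * g k" for k
  proof -
    have "(\<Sum>\<theta>\<in>?I \<rightarrow>\<^sub>E {..<N}. d k * (\<Prod>j=1..n. (complex_of_real \<rho> * w ^ \<theta> j) powi k j))
       = d k * (\<Prod>j=1..n. complex_of_real \<rho> powi k j) * (\<Sum>\<theta>\<in>?I \<rightarrow>\<^sub>E {..<N}. \<Prod>j=1..n. (w ^ \<theta> j) powi k j)"
      by (simp add: power_int_mult_distrib prod.distrib sum_distrib_left mult.assoc)
    also have "(\<Sum>\<theta>\<in>?I \<rightarrow>\<^sub>E {..<N}. \<Prod>j=1..n. (w ^ \<theta> j) powi k j) = (\<Prod>j=1..n. \<Sum>a<N. (w ^ a) powi k j)"
      by (rule prod_sum_PiE[symmetric]) auto
    also have "\<dots> = of_nat N ^ n * (\<Prod>j=1..n. (\<Sum>a<N. (w ^ a) powi k j) / of_nat N)"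
      using N0 by (simp add: prod_dividef)
    finally show ?thesis by (simp add: g_def)
  qed
  ultimately have "((\<lambda>k. of_nat N ^ n * g k) has_sum 0) ?K" by simp
  then have g: "(g has_sum 0) ?K"
    using N0 by (subst (asm) has_sum_cmult_right_iff) auto
  have g_le: "norm (g k) \<le> b k" for k
  proof -
    have "norm ((\<Sum>a<N. (w ^ a) powi k j) / of_nat N) \<le> 1" for j
    proof -
      have "norm (\<Sum>a<N. (w ^ a) powi k j) \<le> real N"
        using norm_sum[of "\<lambda>a. (w ^ a) powi k j" "{..<N}"] by (simp add: nw)
      then show ?thesis using \<open>N > 0\<close> by (simp add: norm_divide)
    qed
    then have "norm (\<Prod>j=1..n. (\<Sum>a<N. (w ^ a) powi k j) / of_nat N) \<le> 1"
      by (simp only: prod_norm[symmetric]) (intro prod_le_1, simp)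
    then have "b k * norm (\<Prod>j=1..n. (\<Sum>a<N. (w ^ a) powi k j) / of_nat N) \<le> b k * 1"
      by (intro mult_left_mono) (simp_all add: b_def)
    then show ?thesis unfolding g_def b_def norm_mult by simp
  qed
  have g0: "g k = 0" if "k \<in> S" "k \<noteq> ?o" for k
  proof -
    have "k \<in> ?K" using that S by auto
    have "\<exists>j\<in>?I. k j \<noteq> 0"
    proof (rule ccontr)
      assume "\<not> (\<exists>j\<in>?I. k j \<noteq> 0)"
      then have "k = ?o" using PiE_arb[OF \<open>k \<in> ?K\<close>] by (auto simp: fun_eq_iff)
      then show False using that(2) by contradiction
    qed
    then obtain j where j: "j \<in> ?I" "k j \<noteq> 0" by blast
    then have "(\<Sum>a<N. (w ^ a) powi k j) = 0"
      unfolding w_def using N[OF that(1)] by (intro sum_roots_of_unity_power_int) auto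
    then have "\<exists>j\<in>?I. (\<Sum>a<N. (w ^ a) powi k j) / of_nat N = 0" using j by auto
    then show ?thesis unfolding g_def by (simp add: prod_zero)
  qed
  have "sum g S' = g ?o"
    using S'(1) by (subst sum.remove[of _ ?o]) (auto simp: S'_def intro!: sum.neutral g0)
  also have "g ?o = d ?o"
    using N0 by (simp add: g_def)
  finally have "sum g S' = d ?o" .
  \<comment> \<open>Since \<open>g\<close> sums to 0, its part outside \<open>S'\<close> is
    \<open>- d ?o\<close>. The tail of \<open>b\<close> bounds it by \<open>\<epsilon>\<close>, half
    the norm of \<open>d ?o\<close>.\<close>
  moreover have "norm (0 - sum g S') \<le> B - sum b S'"
  proof (rule norm_infsum_le)
    show "(g has_sum 0 - sum g S') (?K - S')"
      using S' by (intro has_sum_Diff g has_sum_finite) auto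
    show "(b has_sum B - sum b S') (?K - S')"
      using S' by (intro has_sum_Diff B has_sum_finite) auto
  qed (rule g_le)
  ultimately have "norm (d ?o) \<le> \<epsilon>" using tail by simp
  then show False using \<open>\<epsilon> > 0\<close> by (simp add: \<epsilon>_def)
qed

lemma constant_term_eqI:
  assumes "has_Laurent_expansion_at_0 n F c" and "c (\<lambda>j\<in>{1..n}. 0) = a"
  shows "constant_term n F = a"
  unfolding constant_term_def
proof (rule the_equality)
  show "\<exists>c. has_Laurent_expansion_at_0 n F c \<and> c (\<lambda>j\<in>{1..n}. 0) = a"
    using assms by auto
  show "b = a" if "\<exists>c. has_Laurent_expansion_at_0 n F c \<and> c (\<lambda>j\<in>{1..n}. 0) = b" for b
    using that assms Laurent_constant_coeff_unique by metis
qed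

lemma has_Laurent_expansion_cmult:
  assumes "has_Laurent_expansion_at_0 n F c"
  shows "has_Laurent_expansion_at_0 n (\<lambda>z. a * F z) (\<lambda>k. a * c k)"
proof -
  obtain r where "r > 0" and r: "\<And>z. (\<forall>j\<in>{1..n}. z j \<noteq> 0 \<and> norm (z j) < r) \<Longrightarrow>
        ((\<lambda>k. c k * (\<Prod>j=1..n. z j powi k j)) has_sum F z) ({1..n} \<rightarrow>\<^sub>E UNIV)"
    using assms unfolding has_Laurent_expansion_at_0_def by blast
  then show ?thesis
    unfolding has_Laurent_expansion_at_0_def mult.assoc
    by (intro exI[of _ r]) (auto intro!: has_sum_cmult_right)
qed

lemma has_Laurent_expansion_sum:
  assumes "finite S" and "\<And>i. i \<in> S \<Longrightarrow> has_Laurent_expansion_at_0 n (F i) (c i)"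
  shows "has_Laurent_expansion_at_0 n (\<lambda>z. \<Sum>i\<in>S. F i z) (\<lambda>k. \<Sum>i\<in>S. c i k)"
proof -
  have "\<forall>i\<in>S. \<exists>r. r > 0 \<and> (\<forall>z. (\<forall>j\<in>{1..n}. z j \<noteq> 0 \<and> norm (z j) < r) \<longrightarrow>
        ((\<lambda>k. c i k * (\<Prod>j=1..n. z j powi k j)) has_sum F i z) ({1..n} \<rightarrow>\<^sub>E UNIV))"
    using assms(2) unfolding has_Laurent_expansion_at_0_def by simp
  from bchoice[OF this] obtain r where r: "\<And>i. i \<in> S \<Longrightarrow> r i > 0"
    "\<And>i z. i \<in> S \<Longrightarrow> (\<forall>j\<in>{1..n}. z j \<noteq> 0 \<and> norm (z j) < r i) \<Longrightarrow>
        ((\<lambda>k. c i k * (\<Prod>j=1..n. z j powi k j)) has_sum F i z) ({1..n} \<rightarrow>\<^sub>E UNIV)"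
    by blast
  define R where "R = Min (insert 1 (r ` S))"
  have "R > 0" using assms(1) r by (auto simp: R_def)
  moreover have "R \<le> r i" if "i \<in> S" for i using assms(1) that by (auto simp: R_def)
  ultimately show ?thesis
    unfolding has_Laurent_expansion_at_0_def sum_distrib_right
    by (intro exI[of _ R] conjI allI impI has_sum_sum_finite r(2)) (auto dest: less_le_trans)
qed

lemma has_Laurent_expansion_cong:
  assumes "has_Laurent_expansion_at_0 n F c" and "R > 0"
    and "\<And>z. (\<And>j. j \<in> {1..n} \<Longrightarrow> z j \<noteq> 0 \<and> norm (z j) < R) \<Longrightarrow> G z = F z"
  shows "has_Laurent_expansion_at_0 n G c"
proof -
  obtain r where "r > 0" and r: "\<And>z. (\<forall>j\<in>{1..n}. z j \<noteq> 0 \<and> norm (z j) < r) \<Longrightarrow>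
        ((\<lambda>k. c k * (\<Prod>j=1..n. z j powi k j)) has_sum F z) ({1..n} \<rightarrow>\<^sub>E UNIV)"
    using assms(1) unfolding has_Laurent_expansion_at_0_def by blast
  then show ?thesis
    unfolding has_Laurent_expansion_at_0_def
    using assms(2,3) by (intro exI[of _ "min r R"]) auto
qed

lemma has_Laurent_expansion_prod:
  assumes "R > 0"
    and "\<And>j z. j \<in> {1..n} \<Longrightarrow> z \<noteq> 0 \<Longrightarrow> norm z < R \<Longrightarrow> ((\<lambda>k. e j k * z powi k) has_sum g j z) UNIV"
  shows "has_Laurent_expansion_at_0 n (\<lambda>z. \<Prod>j=1..n. g j (z j)) (\<lambda>k. \<Prod>j=1..n. e j (k j))"
  unfolding has_Laurent_expansion_at_0_def prod.distrib[symmetric]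
  using assms by (intro exI[of _ R] conjI allI impI has_sum_prod_PiE) auto

section \<open>Expansions in one variable\<close>

lemma gegenbauer_has_fps_expansion:
  fixes \<mu> x :: complex
  shows "(\<lambda>z. (1 - 2 * x * z + z ^ 2) powr (- \<mu>)) has_fps_expansion gegenbauer_fps \<mu> x"
proof -
  have "(\<lambda>z. z ^ 2 - 2 * x * z) has_fps_expansion (fps_X ^ 2 - fps_const (2 * x) * fps_X)"
    by (intro fps_expansion_intros)
  \<comment> \<open>The base is 1 at \<open>z = 0\<close>, so near 0 the principal power is the
    branch with value 1 there.\<close>
  from has_fps_expansion_compose[OF has_fps_expansion_binomial_complex[of "- \<mu>"] this]
  show ?thesis by (simp add: gegenbauer_fps_def o_def algebra_simps)
qed

text \<open>The factor \<open>z powi (- p)\<close> shifts the exponents, in either direction. The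
  test \<open>0 \<le> k + p\<close> matters because \<open>nat\<close> maps negative numbers to 0,
  which would give the leading coefficient instead of 0.\<close>

lemma gegenbauer_has_sum_powr:
  fixes \<mu> x :: complex
  obtains r where "r > 0" and "\<And>z. z \<noteq> 0 \<Longrightarrow> norm z < r \<Longrightarrow>
    ((\<lambda>k. (if 0 \<le> k + p then fps_nth (gegenbauer_fps \<mu> x) (nat (k + p)) else 0) * z powi k)
      has_sum ((1 - 2 * x * z + z ^ 2) powr (- \<mu>) * z powi (- p))) UNIV"
proof -
  let ?G = "gegenbauer_fps \<mu> x" and ?f = "\<lambda>z. (1 - 2 * x * z + z ^ 2) powr (- \<mu>)"
  have "fps_conv_radius ?G > 0" and "eventually (\<lambda>z. eval_fps ?G z = ?f z) (nhds 0)"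
    using gegenbauer_has_fps_expansion[of x \<mu>] by (auto simp: has_fps_expansion_def)
  then obtain r1 r2 where r1: "ereal r1 > 0" "ereal r1 < fps_conv_radius ?G"
    and r2: "r2 > 0" "\<And>z. dist z 0 < r2 \<Longrightarrow> eval_fps ?G z = ?f z"
    unfolding eventually_nhds_metric using ereal_dense2 by metis
  define r where "r = min r1 r2"
  show thesis
  proof
    show "r > 0" using r1 r2 by (simp add: r_def)
    fix z :: complex assume z: "z \<noteq> 0" "norm z < r"
    have "ereal (norm z) < fps_conv_radius ?G"
      using z r1 less_trans[of "ereal (norm z)" "ereal r1"] by (simp add: r_def)
    then have "((\<lambda>i. fps_nth ?G i * z ^ i) has_sum eval_fps ?G z) UNIV"
      unfolding eval_fps_def by (intro norm_summable_imp_has_sum norm_summable_fps summable_sums summable_fps)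
    moreover have "eval_fps ?G z = ?f z" using r2(2)[of z] z by (simp add: r_def)
    ultimately have "((\<lambda>i. fps_nth ?G i * z ^ i * z powi (- p)) has_sum (?f z * z powi (- p))) UNIV"
      by (intro has_sum_cmult_left) simp
    moreover have "(\<lambda>i. fps_nth ?G i * z ^ i * z powi (- p))
        = (\<lambda>k. fps_nth ?G (nat (k + p)) * z powi k) \<circ> (\<lambda>i. int i - p)"
    proof
      fix i
      have "z powi (int i - p) = z ^ i * z powi (- p)"
        using power_int_add[of z "int i" "- p"] z by simp
      then show "fps_nth ?G i * z ^ i * z powi (- p)
        = ((\<lambda>k. fps_nth ?G (nat (k + p)) * z powi k) \<circ> (\<lambda>i. int i - p)) i" by simp
    qed
    moreover have "inj (\<lambda>i. int i - p)" by (auto intro: injI)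
    ultimately have "((\<lambda>k. fps_nth ?G (nat (k + p)) * z powi k) has_sum (?f z * z powi (- p))) (range (\<lambda>i. int i - p))"
      by (simp add: has_sum_reindex)
    moreover have "k \<in> range (\<lambda>i. int i - p)" if "0 \<le> k + p" for k
      using that by (intro image_eqI[of _ _ "nat (k + p)"]) auto
    ultimately show "((\<lambda>k. (if 0 \<le> k + p then fps_nth ?G (nat (k + p)) else 0) * z powi k)
        has_sum (?f z * z powi (- p))) UNIV"
      by (subst has_sum_cong_neutral[where T = "range (\<lambda>i. int i - p)"]) auto
  qed
qed

text \<open>The complete homogeneous symmetric polynomial of degree \<open>j - l\<close> in \<open>v 0, \<dots>, v l\<close>: the coefficients of \<open>x ^ j\<close> in
  the Newton basis.\<close>

primrec complete_homogeneous :: "(nat \<Rightarrow> 'a::comm_ring_1) \<Rightarrow> nat \<Rightarrow> nat \<Rightarrow> 'a" where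
  "complete_homogeneous v 0 l = (if l = 0 then 1 else 0)"
| "complete_homogeneous v (Suc j) l =
     (if l = 0 then 0 else complete_homogeneous v j (l - 1)) + v l * complete_homogeneous v j l"

lemma complete_homogeneous_gt: "j < l \<Longrightarrow> complete_homogeneous v j l = 0"
  by (induction j arbitrary: l) auto

lemma complete_homogeneous_same: "complete_homogeneous v j j = 1"
  by (induction j) (auto simp: complete_homogeneous_gt)

text \<open>Multiplying by \<open>x = (x - v l) + v l\<close> sends the \<open>l\<close>-th Newton
  polynomial to the next one plus \<open>v l\<close> times itself, which is the recursion of
  \<open>complete_homogeneous\<close>.\<close>

lemma power_newton_expansion:
  fixes x :: "'a::comm_ring_1"
  assumes "j \<le> n"
  shows "x ^ j = (\<Sum>l\<le>n. (\<Prod>k<l. x - v k) * complete_homogeneous v j l)"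
  using assms
proof (induction j)
  case 0
  have "(\<Sum>l\<le>n. (\<Prod>k<l. x - v k) * complete_homogeneous v 0 l) = (\<Sum>l\<le>n. if l = 0 then 1 else 0)"
    by (intro sum.cong) auto
  then show ?case by simp
next
  case (Suc j)
  let ?N = "\<lambda>l. \<Prod>k<l. x - v k" and ?h = "complete_homogeneous v j"
  obtain n' where n: "n = Suc n'" using Suc.prems by (cases n) auto
  have "x ^ Suc j = (\<Sum>l\<le>n. x * (?N l * ?h l))"
    using Suc by (simp add: sum_distrib_left)
  also have "\<dots> = (\<Sum>l\<le>n. ?N (Suc l) * ?h l) + (\<Sum>l\<le>n. ?N l * (v l * ?h l))"
    unfolding sum.distrib[symmetric] by (intro sum.cong refl) (simp add: algebra_simps)
  also have "(\<Sum>l\<le>n. ?N (Suc l) * ?h l) = (\<Sum>l\<le>n. ?N l * (if l = 0 then 0 else ?h (l - 1)))"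
  proof -
    have "(\<Sum>l\<le>n. ?N l * (if l = 0 then 0 else ?h (l - 1))) = (\<Sum>l\<le>n'. ?N (Suc l) * ?h l)"
      unfolding n sum.atMost_Suc_shift by simp
    then show ?thesis using Suc.prems by (simp add: n complete_homogeneous_gt)
  qed
  finally show ?case by (simp add: sum.distrib algebra_simps)
qed

text \<open>Triangular factorization through the Newton basis: its values at the nodes form a lower
  triangular matrix, and the change of basis is upper triangular with ones on the diagonal.\<close>

lemma det_vandermonde:
  fixes v :: "nat \<Rightarrow> 'a::idom"
  shows "Determinant.det (mat n n (\<lambda>(i, j). v i ^ j)) = (\<Prod>j<n. \<Prod>i<j. v j - v i)"
proof -
  let ?N = "mat n n (\<lambda>(i, l). \<Prod>k<l. v i - v k)"
  let ?H = "mat n n (\<lambda>(l, j). complete_homogeneous v j l)"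
  have "mat n n (\<lambda>(i, j). v i ^ j) = ?N * ?H"
  proof (rule eq_matI)
    fix i j assume "i < dim_row (?N * ?H)" "j < dim_col (?N * ?H)"
    then have ij: "i < n" "j < n" by auto
    then have "{0..<n} = {..n - 1}" by auto
    then show "mat n n (\<lambda>(i, j). v i ^ j) $$ (i, j) = (?N * ?H) $$ (i, j)"
      using ij power_newton_expansion[of j "n - 1" "v i" v] by (auto simp: scalar_prod_def)
  qed auto
  also have "Determinant.det (?N * ?H) = Determinant.det ?N * Determinant.det ?H"
    by (rule det_mult) auto
  also have "Determinant.det ?N = (\<Prod>j<n. \<Prod>i<j. v j - v i)"
    by (subst det_lower_triangular[of n]) (auto simp: prod_list_diag_mat[of _ n] prod_zero_iff)
  also have "Determinant.det ?H = 1"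
    by (subst det_upper_triangular[of _ n]) (auto simp: complete_homogeneous_gt complete_homogeneous_same prod_list_diag_mat[of _ n])
  finally show ?thesis by simp
qed

lemma vandermonde_sum:
  fixes v :: "nat \<Rightarrow> 'a::idom"
  shows "(\<Prod>j<n. \<Prod>i<j. v j - v i) = (\<Sum>p | p permutes {0..<n}. signof p * (\<Prod>i<n. v i ^ p i))"
  unfolding det_vandermonde[symmetric]
  by (subst det_def'[of _ n]) (simp_all add: permutes_atLeast0_less lessThan_atLeast0)

text \<open>A discrete Andreief identity: for fixed \<open>p\<close> the sum over \<open>q\<close>
  is the determinant with rows permuted by \<open>p\<close>, and the two signs of \<open>p\<close>
  cancel, so all \<open>n!\<close> outer terms agree.\<close>

lemma sum_permutations_det:
  fixes E :: "nat \<Rightarrow> nat \<Rightarrow> 'a::comm_ring_1"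
  shows "(\<Sum>p | p permutes {0..<n}. \<Sum>q | q permutes {0..<n}. signof p * signof q * (\<Prod>i<n. E (p i) (q i)))
    = of_nat (fact n) * Determinant.det (mat n n (\<lambda>(i, j). E i j))"
proof -
  let ?D = "Determinant.det (mat n n (\<lambda>(i, j). E i j))"
  note im = permutes_atLeast0_less
  have "(\<Sum>q | q permutes {0..<n}. signof p * signof q * (\<Prod>i<n. E (p i) (q i))) = ?D"
    if p: "p permutes {0..<n}" for p
  proof -
    have "(\<Sum>q | q permutes {0..<n}. signof q * (\<Prod>i<n. E (p i) (q i)))
        = Determinant.det (mat n n (\<lambda>(i, j). E (p i) j))"
      by (subst det_def'[of _ n]) (simp_all add: lessThan_atLeast0 im)
    also have "mat n n (\<lambda>(i, j). E (p i) j) = mat n n (\<lambda>(i, j). mat n n (\<lambda>(i, j). E i j) $$ (p i, j))"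
      by (rule eq_matI) (auto simp: im[OF p])
    also have "Determinant.det \<dots> = signof p * ?D"
      by (rule Determinant.det_permute_rows[OF _ p]) simp
    finally show ?thesis
      by (simp add: mult.assoc sum_distrib_left[symmetric]) (simp add: sign_def)
  qed
  then have "(\<Sum>p | p permutes {0..<n}. \<Sum>q | q permutes {0..<n}. signof p * signof q * (\<Prod>i<n. E (p i) (q i)))
     = (\<Sum>p | p permutes {0..<n}. ?D)"
    by (intro sum.cong) auto
  also have "\<dots> = of_nat (fact n) * ?D"
    using card_permutations[of "{0..<n}" n] by simp
  finally show ?thesis .
qed

lemma det_of_real:
  "Determinant.det (mat n n (\<lambda>(i, j). of_real (a i j) :: 'a::{real_algebra_1, comm_ring_1}))
    = of_real (Determinant.det (mat n n (\<lambda>(i, j). a i j)))"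
  by (simp add: det_def'[of _ n] permutes_atLeast0_less)

lemma prod_pairs_eq:
  "(\<Prod>(i, j)\<in>{(i, j). 1 \<le> i \<and> i < j \<and> j \<le> n}. f i j) = (\<Prod>j<n. \<Prod>i<j. f (Suc i) (Suc j))"
proof -
  have "(\<Prod>j<n. \<Prod>i<j. f (Suc i) (Suc j)) = (\<Prod>(j, i)\<in>Sigma {..<n} (\<lambda>j. {..<j}). f (Suc i) (Suc j))"
    by (rule prod.Sigma) auto
  also have "\<dots> = (\<Prod>(i, j)\<in>{(i, j). 1 \<le> i \<and> i < j \<and> j \<le> n}. f i j)"
    by (rule prod.reindex_bij_witness[of _ "\<lambda>(i, j). (j - 1, i - 1)" "\<lambda>(j, i). (Suc i, Suc j)"]) auto
  finally show ?thesis by simp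
qed

section \<open>The constant term as a determinant of Gegenbauer polynomials\<close>

lemma constant_term_gegenbauer_kernel:
  fixes lam x :: real
  shows "constant_term n
      (\<lambda>z. (\<Prod>j=1..n. (1 - 2 * complex_of_real x * z j + z j ^ 2)
                         powr complex_of_real (- lam - real n + 1) / z j ^ m)
         * (\<Prod>(i, j)\<in>{(i, j). 1 \<le> i \<and> i < j \<and> j \<le> n}.
              (z i - z j) ^ 2 * (1 - 1 / (z i * z j))))
    = complex_of_real (fact n * Determinant.det (mat n n (\<lambda>(i, j).
       if j \<le> m + i then fps_nth (gegenbauer_fps (lam + real j) x) (m + i - j) else 0)))"
    (is "constant_term n ?F = _")
proof -
  let ?P = "{p. p permutes {0..<n}}"
  let ?q = "\<lambda>z. 1 - 2 * complex_of_real x * z + z ^ 2"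
  let ?c = "complex_of_real (- lam - real n + 1)"
  \<comment> \<open>The two Vandermonde expansions contribute \<open>z ^ a * u ^ b\<close> to each
    coordinate. As \<open>u\<close> is the quadratic divided by \<open>z\<close>, the quadratic gets
    the exponent \<open>- \<mu> b\<close> and \<open>z\<close> the exponent \<open>- s a b\<close>;
    thus \<open>s a b\<close> is the index of the series coefficient that lands at exponent
    0.\<close>
  define \<mu> :: "nat \<Rightarrow> complex" where "\<mu> b = complex_of_real (lam + real n - 1 - real b)" for b
  define s :: "nat \<Rightarrow> nat \<Rightarrow> int" where "s a b = int m + int b - int a" for a b
  define e :: "nat \<Rightarrow> nat \<Rightarrow> int \<Rightarrow> complex" where "e a b k = (if 0 \<le> k + s a b
      then fps_nth (gegenbauer_fps (\<mu> b) (complex_of_real x)) (nat (k + s a b)) else 0)" for a b k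
  define g :: "nat \<Rightarrow> nat \<Rightarrow> complex \<Rightarrow> complex" where "g a b z = ?q z powr (- \<mu> b) * z powi (- s a b)" for a b z
  have "\<exists>r>0. \<forall>z. z \<noteq> 0 \<longrightarrow> norm z < r \<longrightarrow> ((\<lambda>k. e a b k * z powi k) has_sum g a b z) UNIV" for a b
    unfolding e_def g_def
    by (rule gegenbauer_has_sum_powr[where \<mu> = "\<mu> b" and x = "complex_of_real x" and p = "s a b"]) blast
  then obtain r where r: "\<And>a b. r a b > 0"
    "\<And>a b z. z \<noteq> 0 \<Longrightarrow> norm z < r a b \<Longrightarrow> ((\<lambda>k. e a b k * z powi k) has_sum g a b z) UNIV"
    by metis
  have pn: "p i < n" if "p \<in> ?P" "i < n" for p i
    using permutes_atLeast0_less that by auto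
  have finP: "finite ?P" by (simp add: finite_permutations)
  have prod_expansion: "has_Laurent_expansion_at_0 n (\<lambda>z. \<Prod>j=1..n. g (p (j - 1)) (p' (j - 1)) (z j))
      (\<lambda>k. \<Prod>j=1..n. e (p (j - 1)) (p' (j - 1)) (k j))" if "p \<in> ?P" "p' \<in> ?P" for p p'
  proof (rule has_Laurent_expansion_prod)
    define R where "R = Min (insert 1 ((\<lambda>(a, b). r a b) ` ({..<n} \<times> {..<n})))"
    show "R > 0" unfolding R_def by (subst Min_gr_iff) (auto simp: r(1))
    fix j and z :: complex
    assume j: "j \<in> {1..n}" and z: "z \<noteq> 0" "norm z < R"
    have "j - 1 < n" using j by auto
    then have "p (j - 1) < n" "p' (j - 1) < n" using pn that by blast+
    then have "R \<le> r (p (j - 1)) (p' (j - 1))"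
      unfolding R_def by (intro Min_le) (auto intro!: image_eqI[of _ _ "(p (j - 1), p' (j - 1))"])
    then show "((\<lambda>k. e (p (j - 1)) (p' (j - 1)) k * z powi k) has_sum g (p (j - 1)) (p' (j - 1)) z) UNIV"
      using z by (intro r(2)) auto
  qed
  define G where "G z = (\<Sum>p\<in>?P. \<Sum>p'\<in>?P. signof p * signof p' * (\<Prod>j=1..n. g (p (j - 1)) (p' (j - 1)) (z j)))" for z
  define C where "C k = (\<Sum>p\<in>?P. \<Sum>p'\<in>?P. signof p * signof p' * (\<Prod>j=1..n. e (p (j - 1)) (p' (j - 1)) (k j)))" for k
  have G: "has_Laurent_expansion_at_0 n G C"
    unfolding G_def C_def by (intro has_Laurent_expansion_sum has_Laurent_expansion_cmult prod_expansion finP)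
  \<comment> \<open>At base 0, \<open>powr\<close> with exponent 0 gives 0 whereas \<open>^\<close>
    gives 1, so zeros of the quadratic are kept out by shrinking the polydisc.\<close>
  have "eventually (\<lambda>z. ?q z \<noteq> 0) (nhds 0)"
  proof -
    have "isCont ?q 0" by (intro continuous_intros)
    then have "(?q \<longlongrightarrow> ?q 0) (nhds 0)" 
      using tendsto_at_iff_tendsto_nhds[of ?q 0] unfolding isCont_def by blast
    then show ?thesis by (rule tendsto_imp_eventually_ne) simp
  qed
  then obtain R where R: "R > 0" "\<And>z. norm z < R \<Longrightarrow> ?q z \<noteq> 0"
    unfolding eventually_nhds_metric by auto
  have FG: "?F z = G z" if z: "\<And>j. j \<in> {1..n} \<Longrightarrow> z j \<noteq> 0 \<and> norm (z j) < R" for z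
  proof -
    let ?v = "\<lambda>i. z (Suc i)"
    let ?u = "\<lambda>i. ?q (?v i) / ?v i"
    have v: "?v i \<noteq> 0" "?q (?v i) \<noteq> 0" if "i < n" for i
      using z[of "Suc i"] R that by auto
    have pair: "(?v i - ?v j) ^ 2 * (1 - 1 / (?v i * ?v j)) = (?v j - ?v i) * (?u j - ?u i)"
      if "j < n" "i < j" for i j
      using v(1)[of i] v(1)[of j] that by (simp add: field_simps power2_eq_square)
    have "(\<Prod>(i, j)\<in>{(i, j). 1 \<le> i \<and> i < j \<and> j \<le> n}. (z i - z j) ^ 2 * (1 - 1 / (z i * z j)))
      = (\<Prod>j<n. \<Prod>i<j. ?v j - ?v i) * (\<Prod>j<n. \<Prod>i<j. ?u j - ?u i)"
      unfolding prod_pairs_eq prod.distrib[symmetric] by (intro prod.cong refl pair) auto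
    also have "\<dots> = (\<Sum>p\<in>?P. \<Sum>p'\<in>?P. signof p * signof p' * ((\<Prod>i<n. ?v i ^ p i) * (\<Prod>i<n. ?u i ^ p' i)))"
      unfolding vandermonde_sum sum_product by (simp only: mult_ac)
    finally have pairs: "(\<Prod>(i, j)\<in>{(i, j). 1 \<le> i \<and> i < j \<and> j \<le> n}. (z i - z j) ^ 2 * (1 - 1 / (z i * z j)))
      = \<dots>" .
    have kernel: "(\<Prod>j=1..n. ?q (z j) powr ?c / z j ^ m) = (\<Prod>i<n. ?q (?v i) powr ?c / ?v i ^ m)"
      by (simp add: prod.atLeast1_atMost_eq)
    have "(\<Prod>i<n. ?q (?v i) powr ?c / ?v i ^ m)
       * (\<Sum>p\<in>?P. \<Sum>p'\<in>?P. signof p * signof p' * ((\<Prod>i<n. ?v i ^ p i) * (\<Prod>i<n. ?u i ^ p' i)))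
       = (\<Sum>p\<in>?P. \<Sum>p'\<in>?P. signof p * signof p'
           * (\<Prod>i<n. ?q (?v i) powr ?c / ?v i ^ m * (?v i ^ p i * ?u i ^ p' i)))"
      unfolding sum_distrib_left prod.distrib by (simp only: mult_ac)
    also have "\<dots> = G z"
      unfolding G_def
    proof (intro sum.cong refl arg_cong2[of _ _ _ _ "(*)"])
      fix p p' assume "p \<in> ?P" "p' \<in> ?P"
      have "?q (?v i) powr ?c / ?v i ^ m * (?v i ^ p i * ?u i ^ p' i) = g (p i) (p' i) (?v i)" if "i < n" for i
      proof -
        have "- \<mu> (p' i) = ?c + of_nat (p' i)" by (simp add: \<mu>_def)
        then have "?q (?v i) powr (- \<mu> (p' i)) = ?q (?v i) powr ?c * ?q (?v i) ^ p' i"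
          using v(2)[OF that] by (simp only: powr_add powr_nat') simp
        moreover have "?v i powi (- s (p i) (p' i)) = ?v i ^ p i / ?v i ^ m / ?v i ^ p' i"
        proof -
          have "- s (p i) (p' i) = int (p i) - int m - int (p' i)" by (simp add: s_def)
          then show ?thesis using v(1)[OF that] by (simp add: power_int_diff)
        qed
        ultimately show ?thesis by (simp add: g_def power_divide)
      qed
      then show "(\<Prod>i<n. ?q (?v i) powr ?c / ?v i ^ m * (?v i ^ p i * ?u i ^ p' i))
         = (\<Prod>j=1..n. g (p (j - 1)) (p' (j - 1)) (z j))"
        by (simp add: prod.atLeast1_atMost_eq)
    qed
    finally show ?thesis unfolding pairs kernel .
  qed
  have "has_Laurent_expansion_at_0 n ?F C"
    using G R(1) FG by (rule has_Laurent_expansion_cong)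
  then have "constant_term n ?F = C (\<lambda>j\<in>{1..n}. 0)"
    by (rule constant_term_eqI) simp
  also have "\<dots> = (\<Sum>p\<in>?P. \<Sum>p'\<in>?P. signof p * signof p' * (\<Prod>i<n. e (p i) (p' i) 0))"
    unfolding C_def by (simp add: prod.atLeast1_atMost_eq)
  also have "\<dots> = of_nat (fact n) * Determinant.det (mat n n (\<lambda>(i, j). e i j 0))"
    by (rule sum_permutations_det)
  \<comment> \<open>Reversing both indices turns the parameter \<open>lam + n - 1 - b\<close> into
    \<open>lam + j\<close> and the coefficient index into \<open>m + i - j\<close>.\<close>
  also have "Determinant.det (mat n n (\<lambda>(i, j). e i j 0))
      = Determinant.det (mat n n (\<lambda>(i, j). e (n - 1 - i) (n - 1 - j) 0))"
    by (rule det_reverse_rows_cols[symmetric])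
  also have "mat n n (\<lambda>(i, j). e (n - 1 - i) (n - 1 - j) 0)
      = mat n n (\<lambda>(i, j). complex_of_real
          (if j \<le> m + i then fps_nth (gegenbauer_fps (lam + real j) x) (m + i - j) else 0))"
  proof (rule eq_matI)
    fix i j
    assume "i < dim_row (mat n n (\<lambda>(i, j). complex_of_real
          (if j \<le> m + i then fps_nth (gegenbauer_fps (lam + real j) x) (m + i - j) else 0)))"
      and "j < dim_col (mat n n (\<lambda>(i, j). complex_of_real
          (if j \<le> m + i then fps_nth (gegenbauer_fps (lam + real j) x) (m + i - j) else 0)))"
    then have ij: "i < n" "j < n" by auto
    then have s: "s (n - 1 - i) (n - 1 - j) = int (m + i) - int j" by (simp add: s_def of_nat_diff)
    have \<mu>: "\<mu> (n - 1 - j) = complex_of_real (lam + real j)" using ij by (simp add: \<mu>_def of_nat_diff)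
    have "nat (int (m + i) - int j) = m + i - j" by simp
    then have "e (n - 1 - i) (n - 1 - j) 0 = complex_of_real
          (if j \<le> m + i then fps_nth (gegenbauer_fps (lam + real j) x) (m + i - j) else 0)"
      unfolding e_def s \<mu> gegenbauer_of_real by auto
    then show "mat n n (\<lambda>(i, j). e (n - 1 - i) (n - 1 - j) 0) $$ (i, j) = mat n n (\<lambda>(i, j). complex_of_real
          (if j \<le> m + i then fps_nth (gegenbauer_fps (lam + real j) x) (m + i - j) else 0)) $$ (i, j)"
      using ij by simp
  qed auto
  finally show ?thesis by (simp add: det_of_real)
qed

theorem mainTheorem15:
  fixes lam x :: real and n m :: nat
  assumes "lam \<noteq> 0"
    and "\<And>k::nat. k \<ge> 1 \<Longrightarrow> lam \<noteq> - (real k / 2)"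
    and "n \<ge> 1" and "m \<ge> 1"
  shows "constant_term n
      (\<lambda>z. (\<Prod>j=1..n. (1 - 2 * complex_of_real x * z j + z j ^ 2)
                         powr complex_of_real (- lam - real n + 1) / z j ^ m)
         * (\<Prod>(i, j)\<in>{(i, j). 1 \<le> i \<and> i < j \<and> j \<le> n}.
              (z i - z j) ^ 2 * (1 - 1 / (z i * z j))))
    = complex_of_real
      ((- 1) ^ (n * m + (m choose 2)) * fact n * 2 ^ (n * m + (m choose 2))
       * (\<Prod>j=0..m-1. pochhammer lam (n + j) / pochhammer (2 * lam) j)
       * det1 m (\<lambda>i j.
           poly (jacobi_num (n + i - 1) (2 * lam + real j - 1) (- real n - real i - lam + 1 / 2)) x
           / poch (2 * lam + 2 * real j - 1) (int n + int i - int j)))"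
proof -
  have nz: "2 * lam + real l \<noteq> 0" for l
    using assms(1) assms(2)[of l] by (cases "l = 0") auto
  have "{0..m - 1} = {..<m}" using \<open>m \<ge> 1\<close> by auto
  then show ?thesis
    unfolding constant_term_gegenbauer_kernel det_gegenbauer_eq_det_jacobi[OF nz]
    by (simp only: mult_ac)
qed

end
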